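(* Consider the individual wage-bargaining protocol described in the context. Suppose that firms always make the first offer, that the response time $\Delta$ between offers tends to zero, and that the capitalists' response time is $\Delta_f=\gamma^f\Delta$ with $\gamma^f>0$. Applying the law of large numbers (so that random waiting times are replaced by their means and random types by their frequencies), the real wages resulting from the subgame perfect equilibrium in the limit $\Delta\to0$ are as follows. (i) If $T(\theta)=T^w/f(\theta_t)$ (the worker is the first to be able to find a new bargaining partner), then $w^{na}_t=b_t+\Psi^{na}_t\,(y_{L_t}-b_t)$ with $$\Psi^{na}_t=\frac{\Gamma^{na}\,[\rho+\alpha\dot m^*_t-g+\lambda_t+f(\theta_t)]}{\rho+\alpha\dot m^*_t-g+\lambda_t+\Gamma^{na}f(\theta_t)},\qquad \Gamma^{na}=\frac{\gamma^f}{1+\gamma^f}.$$ (ii) If $T(\theta)=1/q(\theta_t)$ (the firm is the first to be able to find a new bargaining partner), then $w^{nb}_t=b_t+\Psi^{nb}_t\,(y_{L_t}-b_t)$ with $$\Psi^{nb}_t=\frac{\Gamma^{nb}_t\,[\rho+\alpha\dot m^*_t-g+\lambda_t+f(\theta_t)]}{\rho+\alpha\dot m^*_t-g+\lambda_t+\Gamma^{nb}_tf(\theta_t)},\qquad \Gamma^{nb}_t=\frac{\gamma^f(1-q(\theta_t))}{1+\gamma^f+q(\theta_t)(1-\gamma^f)}.$$ (iii) The average wage rate from individual bargaining is $$w^n_t=b_t+\Psi^n_t\,(y_{L_t}-b_t),\qquad \Psi^n_t=\frac{T^w\,\Psi^{nb}_t+\theta_t\,\Psi^{na}_t}{T^w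+\theta_t}.$$
   Context: Labor market. $\theta>0$ is the vacancy-unemployment ratio, $q(\theta)\in(0,1)$ the rate at which a vacancy is filled, $f(\theta)=\theta q(\theta)$ the job-finding rate, $\lambda>0$ the job separation rate, $\rho$ the discount rate, $g$ the growth rate, $\alpha>0$ a productivity parameter, $\dot m^*$ the rate of change of the automation measure; $\tilde\rho:=\rho+\alpha\dot m^*-g>0$. $y_L$ is the (stationary) marginal product of labor and $b$ the flow value of unemployment. Stationary value functions. With wage $w$, the value of employment $\phi_L$, of unemployment $\phi_U$, and of a filled job to the firm $\pi_L$ satisfy $$\tilde\rho\,\phi_L=w+\lambda(\phi_U-\phi_L),\qquad \tilde\rho\,\phi_U=b+f(\theta)(\phi_L-\phi_U),\qquad \tilde\rho\,\pi_L=y_L-w-\lambda\pi_L,$$ where the value of an unfilled vacancy is zero. In bargaining, $\phi_U$ is taken as given (and then satisfies the second equation at the resulting wage). The surplus to be divided is $S^n=\pi_L+\phi_L-\phi_U$; an individual agreement gives payoff $\pi_L$ to the firm and $\phi_L-\phi_U$ to the worker. Chance move. Let $T^w>0$ be a parameter (the firms' relative hiring capacity). Independent waiting times are drawn: $T^w(\theta)$ exponential with mean $T^w/f(\theta)$ and $T^F(\theta)$ exponential with mean $1/q(\theta)$; $T(\theta)$ is their minimum. Thus $T(\theta)=T^F(\theta)$ with probability $T^w/(T^w+\theta)$ and $T(\theta)=T^w(\theta)$ with probability $\theta/(T^w+\theta)$. In each case $T(\theta)$ is replaced by the mean of the corresponding distribution, $1/q(\theta)$ (treated as an odd integer number of periods)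 or $T^w/f(\theta)$ (treated as an even integer number of periods), respectively. Alternating-offers game. Periods are $0,1,2,\dots$, each of length $\Delta$. The firm makes a wage offer in even periods and the worker in odd periods; the other party accepts (the game ends with the agreed wage) or rejects. When the worker rejects the firm's offer, moving to the next period multiplies the worker's payoff by $\delta^w=(1-\Delta\lambda)e^{-\rho\Delta}$; when the firm rejects the worker's offer, moving to the next period multiplies the firm's payoff by $\delta^f=(1-\Delta_f\lambda)e^{-\rho\Delta_f}$. (a) Case $T(\theta)=1/q(\theta)$: at period $T(\theta)$, upon rejecting the worker's offer, the firm may either continue with the same worker or switch immediately to a new identical unemployed worker, in which case the whole game restarts from period $0$ with the firm offering first. Thus, if $\mathcal M$ is the firm's supremum equilibrium payoff at period $0$ and $\mathcal M_0$ the one at the switching node, $\mathcal M_0=\max\{\delta^f(S^n(1-\delta^w)+\delta^w\mathcal M_0),\mathcal M\}$. (b) Case $T(\theta)=T^w/f(\theta)$: at period $T(\theta)$, upon rejecting the firm's offer, the worker may either continue with the same firm (making the next offer) or switch to a new identical firm, in which case the whole game restarts from period $0$ with the new firm offering first. Thus, if $\mathcal N$ is the worker's supremum equilibrium payoff at period $0$ and $\mathcal N_0$ the one at the switching node, $\mathcal N_0=\max\{\delta^w(S^n(1-\delta^f)+\delta^f\mathcal N_0),\mathcal N\}$. The average wage from individual bargaining is the mean of the wages in the two cases, weighted by the probabilities of the chance move.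
   Formalization: The formal statement additionally assumes that the marginal product of labor is at least the flow value of unemployment (otherwise the surplus is negative and no equilibrium wage is agreed) and that the discount rate ρ is nonnegative. *)

theory Defs
  imports "HOL-Probability.Probability"
begin

section \<open>Extensive games with perfect information\<close>

text \<open>
  Histories are lists of moves with the most recent move first.  A history without legal moves
  is terminal.  Plays may be infinite; an infinite play pays 0 to everybody.
\<close>

record ('p, 'm) game =
  legal_moves :: "'m list \<Rightarrow> 'm set"
  mover :: "'m list \<Rightarrow> 'p"
  utility :: "'p \<Rightarrow> 'm list \<Rightarrow> real"

inductive_set histories :: "('p, 'm) game \<Rightarrow> 'm list set" for G where
  root: "[] \<in> histories G"
| move: "h \<in> histories G \<Longrightarrow> a \<in> legal_moves G h \<Longrightarrow> a # h \<in> histories G"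

definition strategy_profile :: "('p, 'm) game \<Rightarrow> ('m list \<Rightarrow> 'm) \<Rightarrow> bool" where
  "strategy_profile G \<sigma> \<longleftrightarrow>
     (\<forall>h \<in> histories G. legal_moves G h \<noteq> {} \<longrightarrow> \<sigma> h \<in> legal_moves G h)"

definition next_history :: "('p, 'm) game \<Rightarrow> ('m list \<Rightarrow> 'm) \<Rightarrow> 'm list \<Rightarrow> 'm list" where
  "next_history G \<sigma> h = (if legal_moves G h = {} then h else \<sigma> h # h)"

definition ends_at :: "('p, 'm) game \<Rightarrow> ('m list \<Rightarrow> 'm) \<Rightarrow> 'm list \<Rightarrow> 'm list \<Rightarrow> bool" where
  "ends_at G \<sigma> h z \<longleftrightarrow> (\<exists>n. z = (next_history G \<sigma> ^^ n) h) \<and> legal_moves G z = {}"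

definition play_payoff :: "('p, 'm) game \<Rightarrow> ('m list \<Rightarrow> 'm) \<Rightarrow> 'm list \<Rightarrow> 'p \<Rightarrow> real" where
  "play_payoff G \<sigma> h i =
     (if \<exists>z. ends_at G \<sigma> h z then utility G i (THE z. ends_at G \<sigma> h z) else 0)"

definition subgame_perfect :: "('p, 'm) game \<Rightarrow> ('m list \<Rightarrow> 'm) \<Rightarrow> bool" where
  "subgame_perfect G \<sigma> \<longleftrightarrow> strategy_profile G \<sigma> \<and>
     (\<forall>h \<in> histories G. \<forall>i \<sigma>'.
        strategy_profile G \<sigma>' \<and> (\<forall>h'. mover G h' \<noteq> i \<longrightarrow> \<sigma>' h' = \<sigma> h') \<longrightarrow>
        play_payoff G \<sigma>' h i \<le> play_payoff G \<sigma> h i)"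


section \<open>Alternating offers with the possibility to switch partners\<close>

datatype side = Firm | Worker

datatype move = Offer real | Accept | Reject | Continue | Switch

datatype stage = Offering | Responding real | Choosing | Agreed real

fun other_side :: "side \<Rightarrow> side" where
  "other_side Firm = Worker"
| "other_side Worker = Firm"

definition proposer :: "nat \<Rightarrow> side" where
  "proposer t = (if even t then Firm else Worker)"

definition responder :: "nat \<Rightarrow> side" where
  "responder t = other_side (proposer t)"

text \<open>
  In a game state, \<open>match\<close> numbers the successive matches and \<open>period\<close> counts the periods since
  the current match began.  The number \<open>factor s\<close> is the accumulated discount factor of the
  current party on side \<open>s\<close>.
\<close>

record game_state =
  match :: nat
  period :: nat
  stage :: stage
  factor :: "side \<Rightarrow> real"

text \<open>
  The party on side \<open>m\<close> may switch whenever it has rejected an offer in a period \<open>t \<ge> T\<close>.  A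
  delay multiplies the payoff of the party that has just rejected by its discount factor
  \<open>\<delta> s\<close>.  A switch takes no time: the switching party keeps its accumulated factor, and the
  factor of its new partner starts at 1.
\<close>

definition may_switch :: "side \<Rightarrow> nat \<Rightarrow> nat \<Rightarrow> bool" where
  "may_switch m T t \<longleftrightarrow> responder t = m \<and> T \<le> t"

definition next_period :: "(side \<Rightarrow> real) \<Rightarrow> game_state \<Rightarrow> game_state" where
  "next_period \<delta> s = (let p = responder (period s) in
     s\<lparr>period := Suc (period s), stage := Offering,
       factor := (factor s)(p := \<delta> p * factor s p)\<rparr>)"

definition new_match :: "side \<Rightarrow> game_state \<Rightarrow> game_state" where
  "new_match m s =
     s\<lparr>match := Suc (match s), period := 0, stage := Offering,
       factor := (factor s)(other_side m := 1)\<rparr>"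

fun after_move :: "side \<Rightarrow> nat \<Rightarrow> (side \<Rightarrow> real) \<Rightarrow> game_state \<Rightarrow> move \<Rightarrow> game_state" where
  "after_move m T \<delta> s a =
     (case (stage s, a) of
        (Offering, Offer w) \<Rightarrow> s\<lparr>stage := Responding w\<rparr>
      | (Responding w, Accept) \<Rightarrow> s\<lparr>stage := Agreed w\<rparr>
      | (Responding w, Reject) \<Rightarrow>
          if may_switch m T (period s) then s\<lparr>stage := Choosing\<rparr> else next_period \<delta> s
      | (Choosing, Continue) \<Rightarrow> next_period \<delta> s
      | (Choosing, Switch) \<Rightarrow> new_match m s
      | _ \<Rightarrow> s)"

primrec state_at :: "side \<Rightarrow> nat \<Rightarrow> (side \<Rightarrow> real) \<Rightarrow> move list \<Rightarrow> game_state" where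
  "state_at m T \<delta> [] = \<lparr>match = 0, period = 0, stage = Offering, factor = (\<lambda>_. 1)\<rparr>"
| "state_at m T \<delta> (a # h) = after_move m T \<delta> (state_at m T \<delta> h) a"

fun stage_moves :: "stage \<Rightarrow> move set" where
  "stage_moves Offering = range Offer"
| "stage_moves (Responding w) = {Accept, Reject}"
| "stage_moves Choosing = {Continue, Switch}"
| "stage_moves (Agreed w) = {}"

fun active_side :: "nat \<Rightarrow> stage \<Rightarrow> side" where
  "active_side t Offering = proposer t"
| "active_side t (Responding w) = responder t"
| "active_side t Choosing = responder t"
| "active_side t (Agreed w) = proposer t"

text \<open>
  The switching party is one and the same player \<open>(m, 0)\<close> in all matches, whereas its partner in
  match \<open>k\<close> is the player \<open>(other_side m, k)\<close>.
\<close>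

definition player :: "side \<Rightarrow> nat \<Rightarrow> side \<Rightarrow> side \<times> nat" where
  "player m k s = (s, if s = m then 0 else k)"

text \<open>
  An agreement on wage \<open>w\<close> is worth \<open>gain s w\<close>, before discounting, to the party on side \<open>s\<close> of
  the match in which it is reached.  Abandoned partners get 0, which is the net value
  \<open>\<phi>\<^sub>U - \<phi>\<^sub>U\<close> of an unemployed worker and the value of an unfilled vacancy.
\<close>

definition bargaining_game ::
    "side \<Rightarrow> nat \<Rightarrow> (side \<Rightarrow> real) \<Rightarrow> (side \<Rightarrow> real \<Rightarrow> real) \<Rightarrow> (side \<times> nat, move) game" where
  "bargaining_game m T \<delta> gain =
     \<lparr>legal_moves = (\<lambda>h. stage_moves (stage (state_at m T \<delta> h))),
      mover = (\<lambda>h. let s = state_at m T \<delta> h in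
         player m (match s) (active_side (period s) (stage s))),
      utility = (\<lambda>i h. let s = state_at m T \<delta> h in
         case stage s of
           Agreed w \<Rightarrow>
             (if i = player m (match s) (fst i) then factor s (fst i) * gain (fst i) w else 0)
         | _ \<Rightarrow> 0)\<rparr>"

definition agreed_wage ::
    "side \<Rightarrow> nat \<Rightarrow> (side \<Rightarrow> real) \<Rightarrow> (side \<Rightarrow> real \<Rightarrow> real) \<Rightarrow> (move list \<Rightarrow> move) \<Rightarrow> real \<Rightarrow> bool" where
  "agreed_wage m T \<delta> gain \<sigma> w \<longleftrightarrow>
     (\<exists>z. ends_at (bargaining_game m T \<delta> gain) \<sigma> [] z \<and> stage (state_at m T \<delta> z) = Agreed w)"


section \<open>Wages in the labor market\<close>

definition discount :: "real \<Rightarrow> real \<Rightarrow> real \<Rightarrow> real" where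
  "discount \<rho> lam \<tau> = (1 - \<tau> * lam) * exp (- \<rho> * \<tau>)"

fun by_side :: "'a \<Rightarrow> 'a \<Rightarrow> side \<Rightarrow> 'a" where
  "by_side x y Firm = x"
| "by_side x y Worker = y"

text \<open>
  \<open>equilibrium_wage m T r \<rho> lam \<gamma> f y b \<Delta> w\<close>: the wage \<open>w\<close> results from a subgame perfect
  equilibrium when the effective discount rate is \<open>r\<close>, the party on side \<open>m\<close> may switch from
  period \<open>T\<close> on, and the response times are \<open>\<Delta>\<close> for the worker and \<open>\<gamma> * \<Delta>\<close> for the firm.  The value
  \<open>\<phi>\<^sub>U\<close> is the same number for every wage \<open>x\<close> that might be offered in the game; it solves the
  Bellman equation of the unemployed at the resulting wage \<open>w\<close>.
\<close>

definition equilibrium_wage ::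
    "side \<Rightarrow> nat \<Rightarrow> real \<Rightarrow> real \<Rightarrow> real \<Rightarrow> real \<Rightarrow> real \<Rightarrow> real \<Rightarrow> real \<Rightarrow> real \<Rightarrow> real \<Rightarrow> bool" where
  "equilibrium_wage m T r \<rho> lam \<gamma> f y b \<Delta> w \<longleftrightarrow>
     (\<exists>\<phi>\<^sub>U \<phi>\<^sub>L \<pi>\<^sub>L \<sigma> \<delta> gain.
        (\<forall>x. r * \<phi>\<^sub>L x = x + lam * (\<phi>\<^sub>U - \<phi>\<^sub>L x)) \<and>
        (\<forall>x. r * \<pi>\<^sub>L x = y - x - lam * \<pi>\<^sub>L x) \<and>
        r * \<phi>\<^sub>U = b + f * (\<phi>\<^sub>L w - \<phi>\<^sub>U) \<and>
        \<delta> = by_side (discount \<rho> lam (\<gamma> * \<Delta>)) (discount \<rho> lam \<Delta>) \<and>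
        gain = by_side \<pi>\<^sub>L (\<lambda>x. \<phi>\<^sub>L x - \<phi>\<^sub>U) \<and>
        subgame_perfect (bargaining_game m T \<delta> gain) \<sigma> \<and>
        agreed_wage m T \<delta> gain \<sigma> w)"

definition limit_wage :: "(real \<Rightarrow> real \<Rightarrow> bool) \<Rightarrow> real \<Rightarrow> bool" where
  "limit_wage E L \<longleftrightarrow>
     (\<forall>\<^sub>F \<Delta> in at_right 0. \<exists>!w. E \<Delta> w) \<and> ((\<lambda>\<Delta>. THE w. E \<Delta> w) \<longlongrightarrow> L) (at_right 0)"

text \<open>
  \<open>TF\<close> and \<open>TW\<close> are the waiting times of the firm and of the worker; \<open>w_firm\<close> and \<open>w_worker\<close> are
  the wages when the shorter waiting time is \<open>TF\<close> and \<open>TW\<close>, respectively.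
\<close>

definition average_wage ::
    "'a measure \<Rightarrow> ('a \<Rightarrow> real) \<Rightarrow> ('a \<Rightarrow> real) \<Rightarrow> real \<Rightarrow> real \<Rightarrow> real" where
  "average_wage M TF TW w_firm w_worker =
     (\<integral>\<omega>. (if min (TF \<omega>) (TW \<omega>) = TF \<omega> then w_firm else w_worker) \<partial>M)"

definition Gamma_na :: "real \<Rightarrow> real" where
  "Gamma_na \<gamma> = \<gamma> / (1 + \<gamma>)"

definition Gamma_nb :: "real \<Rightarrow> real \<Rightarrow> real" where
  "Gamma_nb \<gamma> q = \<gamma> * (1 - q) / (1 + \<gamma> + q * (1 - \<gamma>))"

definition Psi :: "real \<Rightarrow> real \<Rightarrow> real \<Rightarrow> real \<Rightarrow> real" where
  "Psi r lam f \<Gamma> = \<Gamma> * (r + lam + f) / (r + lam + \<Gamma> * f)"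

end

theory Submission
  imports Defs
begin

text \<open>
  In equilibrium the responder of each period is offered exactly its value of rejecting, which is
  the discounted value of proposing in the next period or, if larger and available, the value of a
  new match.  A solution of this recursion yields a subgame perfect equilibrium.  Conversely, the
  distance between the payoffs of any subgame perfect equilibrium and such a solution shrinks by
  the factor \<open>max (\<delta> Firm) (\<delta> Worker) < 1\<close> when it is propagated through one period: rejecting
  discounts it, and a switch leads to a period 0, in which no further switch is possible, so that
  the distance there has already been discounted.  Hence equilibrium payoffs are unique, their sum
  is the whole surplus, and the agreed wage is the first offer.  The worker's share is explicit,
  and its limit is a quotient of derivatives of products of discount factors at \<open>\<Delta> = 0\<close>.
\<close>

section \<open>Plays and deviations\<close>

text \<open>A supremum and infimum argument would have to treat all periods at once, because a
  switch ties them together: the value at period \<open>T\<close> depends on that at period 0, which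
  is computed backwards from \<open>T\<close>. A uniform distance over all histories handles this
  loop in one stroke. To have a finite start, the contraction needs payoffs between 0 and
  \<open>S\<close>. Nonnegativity rests on infinite plays paying 0; the sign of \<open>S\<close> is
  not assumed but follows from the existence of an agreement. Payoffs alone do not yet give the
  wage, since an agreement could come late or in another match. Strictly positive values on both
  sides exclude another match, and values that exhaust \<open>S\<close> exclude delay. The number
  \<open>\<phi>\<^sub>U\<close> is fixed during bargaining but must fit the wage agreed. Hence the
  game is solved for every \<open>\<phi>\<^sub>U\<close> and a scalar fixed point is closed
  afterwards, which gives \<open>Psi\<close> exactly for each small period length, with the worker's
  initial share as its last argument. In the firm's case that share tends to
  \<open>\<gamma> * k / (1 + k * (1 + \<gamma>))\<close> with \<open>k = T div 2\<close>, and
  \<open>1 / q = T = 2 * k + 1\<close> turns this into \<open>Gamma_nb\<close>.\<close>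

lemma next_history_terminal: "legal_moves G h = {} \<Longrightarrow> next_history G \<sigma> h = h"
  by (simp add: next_history_def)

lemma next_history_move: "legal_moves G h \<noteq> {} \<Longrightarrow> next_history G \<sigma> h = \<sigma> h # h"
  by (simp add: next_history_def)

lemma funpow_next_history_terminal:
  "legal_moves G h = {} \<Longrightarrow> (next_history G \<sigma> ^^ n) h = h"
  by (induction n) (simp_all add: next_history_terminal)

lemma ends_at_unique:
  assumes "ends_at G \<sigma> h z" "ends_at G \<sigma> h z'"
  shows "z = z'"
proof -
  have *: "(next_history G \<sigma> ^^ n) h = (next_history G \<sigma> ^^ k) h"
    if "n \<le> k" "legal_moves G ((next_history G \<sigma> ^^ n) h) = {}" for n k
  proof -
    have "(next_history G \<sigma> ^^ k) h = (next_history G \<sigma> ^^ (k - n)) ((next_history G \<sigma> ^^ n) h)"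
      using that(1) by (metis funpow_add le_add_diff_inverse2 o_apply)
    then show ?thesis
      using funpow_next_history_terminal[OF that(2)] by metis
  qed
  from assms obtain n k where "z = (next_history G \<sigma> ^^ n) h" "legal_moves G z = {}"
    "z' = (next_history G \<sigma> ^^ k) h" "legal_moves G z' = {}"
    unfolding ends_at_def by blast
  then show ?thesis
    using *[of n k] *[of k n] by (metis nat_le_linear)
qed

lemma play_payoff_ends_at: "ends_at G \<sigma> h z \<Longrightarrow> play_payoff G \<sigma> h i = utility G i z"
  unfolding play_payoff_def using ends_at_unique
  by (metis (no_types, lifting) the_equality)

lemma ends_at_terminal: "legal_moves G h = {} \<Longrightarrow> ends_at G \<sigma> h h"
  unfolding ends_at_def by (metis funpow_0)

lemma play_payoff_terminal: "legal_moves G h = {} \<Longrightarrow> play_payoff G \<sigma> h i = utility G i h"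
  by (rule play_payoff_ends_at[OF ends_at_terminal])

lemma ends_at_next_history: "ends_at G \<sigma> (next_history G \<sigma> h) z \<longleftrightarrow> ends_at G \<sigma> h z"
proof
  assume "ends_at G \<sigma> (next_history G \<sigma> h) z"
  then show "ends_at G \<sigma> h z"
    unfolding ends_at_def by (metis comp_apply funpow_Suc_right)
next
  assume "ends_at G \<sigma> h z"
  then obtain n where n: "z = (next_history G \<sigma> ^^ n) h" "legal_moves G z = {}"
    unfolding ends_at_def by blast
  then have "z = (next_history G \<sigma> ^^ Suc n) h"
    by (simp add: next_history_def)
  with n(2) show "ends_at G \<sigma> (next_history G \<sigma> h) z"
    unfolding ends_at_def by (metis comp_apply funpow_Suc_right)
qed

lemma play_payoff_next_history: "play_payoff G \<sigma> (next_history G \<sigma> h) i = play_payoff G \<sigma> h i"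
  unfolding play_payoff_def ends_at_next_history ..

lemma play_payoff_move:
  "legal_moves G h \<noteq> {} \<Longrightarrow> play_payoff G \<sigma> (\<sigma> h # h) i = play_payoff G \<sigma> h i"
  using play_payoff_next_history[of G \<sigma> h i] by (simp add: next_history_def)

lemma next_history_in_histories:
  "strategy_profile G \<sigma> \<Longrightarrow> h \<in> histories G \<Longrightarrow> next_history G \<sigma> h \<in> histories G"
  by (auto simp: next_history_def strategy_profile_def intro: histories.move)

lemma funpow_in_histories:
  "strategy_profile G \<sigma> \<Longrightarrow> h \<in> histories G \<Longrightarrow> (next_history G \<sigma> ^^ n) h \<in> histories G"
  by (induction n) (auto intro: next_history_in_histories)

text \<open>The deviating profile is \<open>\<sigma>(h := a)\<close>. Histories only grow, so play
  from \<open>a # h\<close> never meets \<open>h\<close> again and coincides with play under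
  \<open>\<sigma>\<close>.\<close>

lemma subgame_perfect_deviation:
  assumes "subgame_perfect G \<sigma>" and h: "h \<in> histories G" and a: "a \<in> legal_moves G h"
  shows "play_payoff G \<sigma> (a # h) (mover G h) \<le> play_payoff G \<sigma> h (mover G h)"
proof -
  define \<tau> where "\<tau> = \<sigma>(h := a)"
  have "strategy_profile G \<tau>"
    using assms unfolding subgame_perfect_def strategy_profile_def \<tau>_def by auto
  then have "play_payoff G \<tau> h (mover G h) \<le> play_payoff G \<sigma> h (mover G h)"
    using assms unfolding subgame_perfect_def by (auto simp: \<tau>_def)
  moreover have "(next_history G \<tau> ^^ n) (a # h) = (next_history G \<sigma> ^^ n) (a # h) \<and>
      length h < length ((next_history G \<sigma> ^^ n) (a # h))" for n
    by (induction n) (auto simp: next_history_def \<tau>_def)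
  then have "ends_at G \<tau> (a # h) = ends_at G \<sigma> (a # h)"
    by (intro ext) (simp add: ends_at_def)
  then have "play_payoff G \<tau> (a # h) (mover G h) = play_payoff G \<sigma> (a # h) (mover G h)"
    by (simp add: play_payoff_def)
  moreover have "play_payoff G \<tau> (a # h) (mover G h) = play_payoff G \<tau> h (mover G h)"
    using play_payoff_move[of G h \<tau>] a by (auto simp: \<tau>_def)
  ultimately show ?thesis by simp
qed

text \<open>
  Infinite plays pay 0, so besides the one-step conditions it suffices that every infinite play
  passes through a history at which the candidate value is nonnegative.
\<close>

lemma subgame_perfectI:
  assumes profile: "strategy_profile G \<sigma>"
    and ends: "\<And>h. h \<in> histories G \<Longrightarrow> \<exists>z. ends_at G \<sigma> h z"
    and terminal: "\<And>h i. h \<in> histories G \<Longrightarrow> legal_moves G h = {} \<Longrightarrow> U i h = utility G i h"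
    and path: "\<And>h i. h \<in> histories G \<Longrightarrow> legal_moves G h \<noteq> {} \<Longrightarrow> U i (\<sigma> h # h) = U i h"
    and deviation: "\<And>h a. h \<in> histories G \<Longrightarrow> a \<in> legal_moves G h \<Longrightarrow>
      U (mover G h) (a # h) \<le> U (mover G h) h"
    and infinite_play: "\<And>\<tau> h i. strategy_profile G \<tau> \<Longrightarrow> h \<in> histories G \<Longrightarrow>
      \<exists>n. legal_moves G ((next_history G \<tau> ^^ n) h) = {} \<or> 0 \<le> U i ((next_history G \<tau> ^^ n) h)"
  shows "subgame_perfect G \<sigma>"
  unfolding subgame_perfect_def
proof (intro conjI ballI allI impI profile)
  fix h i \<tau>
  assume h: "h \<in> histories G"
    and *: "strategy_profile G \<tau> \<and> (\<forall>h'. mover G h' \<noteq> i \<longrightarrow> \<tau> h' = \<sigma> h')"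
  then have \<tau>: "strategy_profile G \<tau>" by simp
  have "U i ((next_history G \<sigma> ^^ n) h) = U i h" for n
    using funpow_in_histories[OF profile h]
    by (induction n) (auto simp: next_history_def path)
  moreover obtain z where z: "ends_at G \<sigma> h z"
    using ends h by blast
  ultimately have U: "play_payoff G \<sigma> h i = U i h"
    using play_payoff_ends_at[OF z] terminal funpow_in_histories[OF profile h]
    unfolding ends_at_def by metis
  \<comment> \<open>Along a play of \<open>\<tau>\<close> the value \<open>U i\<close> never rises:
    moves of the other players are those of \<open>\<sigma>\<close> and preserve it, moves of
    \<open>i\<close> are covered by \<open>deviation\<close>.\<close>
  have le: "U i ((next_history G \<tau> ^^ n) h) \<le> U i h" for n
  proof (induction n)
    case (Suc n)
    define h' where "h' = (next_history G \<tau> ^^ n) h"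
    have h': "h' \<in> histories G"
      unfolding h'_def by (rule funpow_in_histories[OF \<tau> h])
    have "U i (next_history G \<tau> h') \<le> U i h'"
    proof (cases "legal_moves G h' = {} \<or> mover G h' \<noteq> i")
      case True
      have "U i (\<sigma> h' # h') = U i h'" if "legal_moves G h' \<noteq> {}"
        using path[OF h' that] .
      with True * show ?thesis
        by (cases "legal_moves G h' = {}") (simp_all add: next_history_def)
    next
      case False
      then show ?thesis
        using deviation[OF h', of "\<tau> h'"] \<tau> h' by (auto simp: next_history_def strategy_profile_def)
    qed
    with Suc show ?case by (simp add: h'_def)
  qed simp
  show "play_payoff G \<tau> h i \<le> play_payoff G \<sigma> h i"
  proof (cases "\<exists>z. ends_at G \<tau> h z")
    case True
    then obtain z where z: "ends_at G \<tau> h z" by blast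
    then obtain n where "z = (next_history G \<tau> ^^ n) h" "legal_moves G z = {}"
      unfolding ends_at_def by blast
    then show ?thesis
      using play_payoff_ends_at[OF z] le[of n] U terminal funpow_in_histories[OF \<tau> h] by metis
  next
    case False
    then have "play_payoff G \<tau> h i = 0"
      by (simp add: play_payoff_def)
    \<comment> \<open>An infinite play pays 0, which is at most the nonnegative value found on the
      way, and that is at most the value at \<open>h\<close>.\<close>
    moreover obtain n where "0 \<le> U i ((next_history G \<tau> ^^ n) h)"
      using infinite_play[OF \<tau> h] False unfolding ends_at_def by blast
    ultimately show ?thesis
      using le[of n] U by simp
  qed
qed

section \<open>Equilibria of the bargaining game\<close>

lemma other_side_simps [simp]:
  "other_side (other_side s) = s" "other_side s \<noteq> s" "s \<noteq> other_side s"
  by (cases s; simp)+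

lemma not_side_eq: "s \<noteq> s' \<Longrightarrow> s = other_side s'"
  by (cases s; cases s') auto

lemma proposer_responder_simps [simp]:
  "proposer t \<noteq> responder t" "responder t \<noteq> proposer t"
  by (simp_all add: responder_def)

lemma proposer_responder_0 [simp]: "proposer 0 = Firm" "responder 0 = Worker"
  by (simp_all add: responder_def proposer_def)

lemma responder_Suc [simp]: "responder (Suc t) = proposer t"
  by (simp add: responder_def proposer_def)

lemma proposer_Suc [simp]: "proposer (Suc t) = responder t"
  by (simp add: responder_def proposer_def)

lemma other_side_responder [simp]: "other_side (responder t) = proposer t"
  by (simp add: responder_def)

lemma other_side_proposer [simp]: "other_side (proposer t) = responder t"
  by (simp add: responder_def)

lemma may_switch_responder: "may_switch m T t \<Longrightarrow> responder t = m"
  by (simp add: may_switch_def)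

lemma fst_player [simp]: "fst (player m k s) = s"
  by (simp add: player_def)

text \<open>Turns a vector indexed by sides into payoffs of players; former and future partners get
  0. The same form covers agreed gains and continuation values.\<close>

definition match_payoff ::
    "side \<Rightarrow> game_state \<Rightarrow> (side \<Rightarrow> real) \<Rightarrow> side \<times> nat \<Rightarrow> real" where
  "match_payoff m s v i =
     (if i = player m (match s) (fst i) then factor s (fst i) * v (fst i) else 0)"

lemma match_payoff_player [simp]:
  "match_payoff m s v (player m (match s) d) = factor s d * v d"
  by (simp add: match_payoff_def)

lemma match_payoff_stage [simp]: "match_payoff m (s\<lparr>stage := x\<rparr>) v i = match_payoff m s v i"
  by (simp add: match_payoff_def)

definition rejected :: "side \<Rightarrow> nat \<Rightarrow> (side \<Rightarrow> real) \<Rightarrow> game_state \<Rightarrow> game_state" where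
  "rejected m T \<delta> s = (if may_switch m T (period s) then s\<lparr>stage := Choosing\<rparr> else next_period \<delta> s)"

lemma after_move_simps:
  "stage s = Offering \<Longrightarrow> after_move m T \<delta> s (Offer w) = s\<lparr>stage := Responding w\<rparr>"
  "stage s = Responding w \<Longrightarrow> after_move m T \<delta> s Accept = s\<lparr>stage := Agreed w\<rparr>"
  "stage s = Responding w \<Longrightarrow> after_move m T \<delta> s Reject = rejected m T \<delta> s"
  "stage s = Choosing \<Longrightarrow> after_move m T \<delta> s Continue = next_period \<delta> s"
  "stage s = Choosing \<Longrightarrow> after_move m T \<delta> s Switch = new_match m s"
  by (simp_all add: rejected_def)

declare after_move.simps [simp del]

lemma next_period_simps [simp]:
  "match (next_period \<delta> s) = match s"
  "period (next_period \<delta> s) = Suc (period s)"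
  "stage (next_period \<delta> s) = Offering"
  "factor (next_period \<delta> s) d =
     (if d = responder (period s) then \<delta> d * factor s d else factor s d)"
  by (auto simp: next_period_def Let_def)

lemma new_match_simps [simp]:
  "match (new_match m s) = Suc (match s)"
  "period (new_match m s) = 0"
  "stage (new_match m s) = Offering"
  "factor (new_match m s) d = (if d = m then factor s d else 1)"
  by (auto simp: new_match_def not_side_eq)

lemma stage_move_cases [consumes 1, case_names offer accept reject continue switch]:
  assumes "a \<in> stage_moves (stage s)"
  obtains w where "stage s = Offering" "a = Offer w" "after_move m T \<delta> s a = s\<lparr>stage := Responding w\<rparr>"
  | w where "stage s = Responding w" "a = Accept" "after_move m T \<delta> s a = s\<lparr>stage := Agreed w\<rparr>"
  | w where "stage s = Responding w" "a = Reject" "after_move m T \<delta> s a = rejected m T \<delta> s"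
  | "stage s = Choosing" "a = Continue" "after_move m T \<delta> s a = next_period \<delta> s"
  | "stage s = Choosing" "a = Switch" "after_move m T \<delta> s a = new_match m s"
  using assms by (cases "stage s") (auto simp: after_move_simps)

text \<open>A wage is a pure transfer of \<open>S\<close>, and bijectivity makes every division of
  \<open>S\<close> the result of exactly one wage, divisions outside the range from 0 to
  \<open>S\<close> included. \<open>S\<close> may be negative here.\<close>

locale wage_bargaining =
  fixes m :: side and T :: nat and \<delta> :: "side \<Rightarrow> real" and gain :: "side \<Rightarrow> real \<Rightarrow> real"
    and S :: real
  assumes discount_pos: "0 < \<delta> s" and discount_less_1: "\<delta> s < 1"
    and gain_sum: "gain Firm x + gain Worker x = S"
    and gain_bij: "bij (gain Worker)"
begin

abbreviation "G \<equiv> bargaining_game m T \<delta> gain"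
abbreviation "st \<equiv> state_at m T \<delta>"
abbreviation "party h s \<equiv> player m (match (st h)) s"

lemma legal_moves_G [simp]: "legal_moves G h = stage_moves (stage (st h))"
  by (simp add: bargaining_game_def)

lemma mover_G [simp]: "mover G h = party h (active_side (period (st h)) (stage (st h)))"
  by (simp add: bargaining_game_def Let_def)

lemma utility_G: "stage (st h) = Agreed w \<Longrightarrow> utility G i h = match_payoff m (st h) (\<lambda>s. gain s w) i"
  by (simp add: bargaining_game_def Let_def match_payoff_def)

lemma terminal_iff: "stage_moves x = {} \<longleftrightarrow> (\<exists>w. x = Agreed w)"
  by (cases x) auto

lemma gain_other: "gain (other_side s) x = S - gain s x"
  using gain_sum[of x] by (cases s) auto

lemma gain_proposer: "gain (proposer t) x = S - gain (responder t) x"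
  by (metis gain_other other_side_responder)

lemma gain_surj: "\<exists>x. gain s x = v"
proof (cases s)
  case Firm
  obtain x where "gain Worker x = S - v"
    using gain_bij by (metis bij_pointE)
  then show ?thesis
    using gain_sum[of x] Firm by (intro exI[of _ x]) simp
next
  case Worker
  then show ?thesis
    using gain_bij by (metis bij_pointE)
qed

text \<open>Positive factors allow payoffs to be divided by them. The second part makes the mover at
  \<open>Choosing\<close> the switching player \<open>(m, 0)\<close>.\<close>

lemma history_invariant:
  assumes "h \<in> histories G"
  shows "0 < factor (st h) s \<and> (stage (st h) = Choosing \<longrightarrow> may_switch m T (period (st h)))"
  using assms
proof (induction arbitrary: s)
  case (move h a)
  then have "a \<in> stage_moves (stage (st h))" by simp
  then show ?case
    using move(3) discount_pos
    by (cases rule: stage_move_cases[where m = m and T = T and \<delta> = \<delta>]) (auto simp: rejected_def)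
qed simp

lemmas factor_pos = history_invariant[THEN conjunct1]

lemma choosing_may_switch:
  "h \<in> histories G \<Longrightarrow> stage (st h) = Choosing \<Longrightarrow> may_switch m T (period (st h))"
  using history_invariant by blast

text \<open>Two moves suffice: a response leads to an agreement, an offering stage or a choice, and
  a choice leads to an offering stage. This serves both termination and the condition on infinite
  plays.\<close>

lemma infinitely_often_offering:
  assumes "strategy_profile G \<sigma>" "h \<in> histories G"
  shows "\<exists>n. let x = stage (st ((next_history G \<sigma> ^^ n) h)) in x = Offering \<or> stage_moves x = {}"
proof -
  define h' where "h' n = (next_history G \<sigma> ^^ n) h" for n
  have step: "stage_moves (stage (st (h' (Suc n)))) = {} \<or> stage (st (h' (Suc n))) = Offering \<or>
      (stage (st (h' (Suc n))) = Choosing \<and> stage (st (h' n)) \<noteq> Choosing)"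
    if "stage (st (h' n)) \<noteq> Offering" "stage_moves (stage (st (h' n))) \<noteq> {}" for n
  proof -
    have "\<sigma> (h' n) \<in> stage_moves (stage (st (h' n)))"
      using that assms funpow_in_histories[OF assms, of n]
      by (auto simp: strategy_profile_def h'_def)
    then show ?thesis
      using that
      by (cases rule: stage_move_cases[where m = m and T = T and \<delta> = \<delta>])
        (auto simp: h'_def next_history_def rejected_def)
  qed
  have "\<exists>n. stage (st (h' n)) = Offering \<or> stage_moves (stage (st (h' n))) = {}"
    using step[of 0] step[of 1] by (metis One_nat_def)
  then show ?thesis by (simp add: h'_def Let_def)
qed

text \<open>
  \<open>V t s\<close> is the value for side \<open>s\<close> of a match that has reached period \<open>t\<close>.  The responder is
  held down to its value of rejecting.
\<close>

definition equilibrium_values :: "(nat \<Rightarrow> side \<Rightarrow> real) \<Rightarrow> bool" where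
  "equilibrium_values V \<longleftrightarrow>
     (\<forall>t s. 0 \<le> V t s) \<and> (\<forall>t. V t Firm + V t Worker = S) \<and>
     (\<forall>t. V t (responder t) =
        (let c = \<delta> (responder t) * V (Suc t) (responder t)
         in if may_switch m T t then max c (V 0 m) else c))"

text \<open>An indifferent responder must accept, otherwise the proposer would have no best offer.
  At \<open>Agreed\<close> no move is legal and the value is a dummy.\<close>

definition equilibrium_move :: "(nat \<Rightarrow> side \<Rightarrow> real) \<Rightarrow> game_state \<Rightarrow> move" where
  "equilibrium_move V s = (let t = period s; d = responder t in
     case stage s of
       Offering \<Rightarrow> Offer (SOME x. gain d x = V t d)
     | Responding w \<Rightarrow> if V t d \<le> gain d w then Accept else Reject
     | Choosing \<Rightarrow> if V 0 m \<le> \<delta> m * V (Suc t) m then Continue else Switch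
     | Agreed _ \<Rightarrow> Accept)"

abbreviation offering_payoff :: "(nat \<Rightarrow> side \<Rightarrow> real) \<Rightarrow> game_state \<Rightarrow> side \<times> nat \<Rightarrow> real" where
  "offering_payoff V s \<equiv> match_payoff m s (V (period s))"

definition choosing_payoff :: "(nat \<Rightarrow> side \<Rightarrow> real) \<Rightarrow> game_state \<Rightarrow> side \<times> nat \<Rightarrow> real" where
  "choosing_payoff V s =
     (if V 0 m \<le> \<delta> m * V (Suc (period s)) m then offering_payoff V (next_period \<delta> s)
      else offering_payoff V (new_match m s))"

definition rejection_payoff :: "(nat \<Rightarrow> side \<Rightarrow> real) \<Rightarrow> game_state \<Rightarrow> side \<times> nat \<Rightarrow> real" where
  "rejection_payoff V s =
     (if may_switch m T (period s) then choosing_payoff V s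
      else offering_payoff V (next_period \<delta> s))"

text \<open>The value function for \<open>subgame_perfectI\<close>: equilibrium moves are unfolded
  until the next offering stage, where \<open>V\<close> is read off.\<close>

definition state_payoff :: "(nat \<Rightarrow> side \<Rightarrow> real) \<Rightarrow> game_state \<Rightarrow> side \<times> nat \<Rightarrow> real" where
  "state_payoff V s =
     (case stage s of
        Offering \<Rightarrow> offering_payoff V s
      | Responding w \<Rightarrow>
          if V (period s) (responder (period s)) \<le> gain (responder (period s)) w
          then match_payoff m s (\<lambda>d. gain d w) else rejection_payoff V s
      | Choosing \<Rightarrow> choosing_payoff V s
      | Agreed w \<Rightarrow> match_payoff m s (\<lambda>d. gain d w))"

lemma choosing_payoff_stage [simp]: "choosing_payoff V (s\<lparr>stage := x\<rparr>) = choosing_payoff V s"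
  by (auto simp: choosing_payoff_def fun_eq_iff match_payoff_def)

lemma rejection_payoff_stage [simp]: "rejection_payoff V (s\<lparr>stage := x\<rparr>) = rejection_payoff V s"
  by (auto simp: rejection_payoff_def fun_eq_iff match_payoff_def)

lemma state_payoff_rejected: "state_payoff V (rejected m T \<delta> s) = rejection_payoff V s"
  by (simp add: state_payoff_def rejected_def rejection_payoff_def)

section \<open>Verification of the candidate equilibrium\<close>

context
  fixes V assumes V: "equilibrium_values V"
begin

lemma V_nonneg: "0 \<le> V t s"
  using V by (simp add: equilibrium_values_def)

lemma V_other: "V t (other_side s) = S - V t s"
  using V by (cases s) (auto simp: equilibrium_values_def algebra_simps)

lemma V_proposer: "V t (proposer t) = S - V t (responder t)"
  by (metis V_other other_side_responder)

lemma V_responder: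
  "V t (responder t) =
    (if may_switch m T t then max (\<delta> (responder t) * V (Suc t) (responder t)) (V 0 m)
     else \<delta> (responder t) * V (Suc t) (responder t))"
  using V unfolding equilibrium_values_def Let_def by blast

text \<open>The recursion in \<open>equilibrium_values\<close> is made for this equality. In the
  switching case it matters that \<open>m\<close> remains the same player with the same factor in
  the new match.\<close>

lemma rejection_payoff_responder:
  "rejection_payoff V s (player m (match s) (responder (period s))) =
     factor s (responder (period s)) * V (period s) (responder (period s))"
proof -
  have "player m (match s) m = player m (Suc (match s)) m"
    by (simp add: player_def)
  then show ?thesis
    by (auto simp: rejection_payoff_def choosing_payoff_def V_responder[of "period s"]
        match_payoff_def max_def may_switch_def)
qed

text \<open>A proposer cannot gain from being rejected. If it is abandoned, it gets 0. Otherwise its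
  own factor is unchanged, but the responder's next value is \<open>V t\<close> divided by a
  discount factor, hence no smaller, and the remainder of \<open>S\<close> is no larger.\<close>

lemma rejection_payoff_proposer:
  assumes "0 < factor s (proposer (period s))"
  shows "rejection_payoff V s (player m (match s) (proposer (period s))) \<le>
     factor s (proposer (period s)) * V (period s) (proposer (period s))"
proof (cases "may_switch m T (period s) \<and> \<not> V 0 m \<le> \<delta> m * V (Suc (period s)) m")
  case True
  then have "proposer (period s) \<noteq> m"
    by (metis may_switch_responder proposer_responder_simps(1))
  then show ?thesis
    using True assms V_nonneg
    by (auto simp: rejection_payoff_def choosing_payoff_def match_payoff_def player_def)
next
  case False
  let ?t = "period s"
  have "V ?t (responder ?t) = \<delta> (responder ?t) * V (Suc ?t) (responder ?t)"
    using False V_responder[of ?t] may_switch_responder[of m T ?t] by auto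
  also have "\<dots> \<le> V (Suc ?t) (responder ?t)"
    using V_nonneg discount_less_1 by (simp add: mult_left_le_one_le less_imp_le discount_pos)
  finally have "V (Suc ?t) (proposer ?t) \<le> V ?t (proposer ?t)"
    using V_proposer[of "Suc ?t"] V_proposer[of ?t] V_other[of "Suc ?t" "responder ?t"] by simp
  then show ?thesis
    using False assms by (auto simp: rejection_payoff_def choosing_payoff_def match_payoff_def)
qed

theorem equilibrium_move_subgame_perfect: "subgame_perfect G (\<lambda>h. equilibrium_move V (st h))"
proof (rule subgame_perfectI[where U = "\<lambda>i h. state_payoff V (st h) i"])
  let ?\<sigma> = "\<lambda>h. equilibrium_move V (st h)"
  show profile: "strategy_profile G ?\<sigma>"
    by (auto simp: strategy_profile_def equilibrium_move_def Let_def split: stage.splits)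
  have offer: "gain d (SOME x. gain d x = v) = v" for d v
    using someI_ex[OF gain_surj] .
  show "\<exists>z. ends_at G ?\<sigma> h z" if hist: "h \<in> histories G" for h
  proof -
    have ends: "\<exists>z. ends_at G ?\<sigma> h z" if h: "stage (st h) = Offering" for h
    proof -
      have "(next_history G ?\<sigma> ^^ 2) h = Accept # ?\<sigma> h # h"
        using h by (simp add: numeral_2_eq_2 next_history_def equilibrium_move_def Let_def
            after_move_simps offer)
      moreover have "stage_moves (stage (st (Accept # ?\<sigma> h # h))) = {}"
        using h by (simp add: equilibrium_move_def after_move_simps Let_def)
      ultimately show ?thesis
        unfolding ends_at_def legal_moves_G by metis
    qed
    obtain n where "let x = stage (st ((next_history G ?\<sigma> ^^ n) h)) in x = Offering \<or> stage_moves x = {}"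
      using infinitely_often_offering[OF profile hist] by blast
    then have "\<exists>z. ends_at G ?\<sigma> ((next_history G ?\<sigma> ^^ n) h) z"
      using ends ends_at_terminal[of G] by (auto simp: Let_def)
    moreover have "ends_at G ?\<sigma> ((next_history G ?\<sigma> ^^ n) h) z \<longleftrightarrow> ends_at G ?\<sigma> h z" for z
      by (induction n) (simp_all add: ends_at_next_history)
    ultimately show ?thesis by simp
  qed
  show "state_payoff V (st h) i = utility G i h" if "legal_moves G h = {}" for h i
    using that by (auto simp: terminal_iff utility_G state_payoff_def)
  show "state_payoff V (st (?\<sigma> h # h)) i = state_payoff V (st h) i"
    if "legal_moves G h \<noteq> {}" for h i
  proof (cases "stage (st h)")
    case Offering
    \<comment> \<open>The wage is chosen to fit the responder's value; the proposer's gain then fits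
      too, since gains and values both sum to \<open>S\<close>.\<close>
    have "(\<lambda>d. gain d (SOME x. gain (responder (period (st h))) x = v)) = V (period (st h))"
      if "v = V (period (st h)) (responder (period (st h)))" for v
    proof
      fix d
      show "gain d (SOME x. gain (responder (period (st h))) x = v) = V (period (st h)) d"
        using that offer[of "responder (period (st h))" v] not_side_eq[of d "responder (period (st h))"]
        by (cases "d = responder (period (st h))") (auto simp: gain_proposer V_proposer)
    qed
    with Offering show ?thesis
      by (simp add: equilibrium_move_def Let_def after_move_simps state_payoff_def offer)
  next
    case (Responding w)
    then show ?thesis
      by (auto simp: equilibrium_move_def Let_def after_move_simps state_payoff_rejected)
        (auto simp: state_payoff_def)
  next
    case Choosing
    then show ?thesis
      by (auto simp: equilibrium_move_def Let_def after_move_simps state_payoff_def choosing_payoff_def)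
  qed (use that in auto)
  show "state_payoff V (st (a # h)) (mover G h) \<le> state_payoff V (st h) (mover G h)"
    if h: "h \<in> histories G" and a: "a \<in> legal_moves G h" for h a
  proof -
    let ?s = "st h" let ?t = "period (st h)"
    note pos = factor_pos[OF h]
    from a have "a \<in> stage_moves (stage ?s)" by simp
    then show ?thesis
    proof (cases rule: stage_move_cases[where m = m and T = T and \<delta> = \<delta>])
      case (offer w)
      have "factor ?s (proposer ?t) * gain (proposer ?t) w \<le> factor ?s (proposer ?t) * V ?t (proposer ?t)"
        if "V ?t (responder ?t) \<le> gain (responder ?t) w"
        using that pos[of "proposer ?t"] by (intro mult_left_mono) (auto simp: gain_proposer V_proposer)
      then show ?thesis
        using offer rejection_payoff_proposer[OF pos] by (simp add: state_payoff_def)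
    next
      case (accept w)
      then show ?thesis
        using pos[of "responder ?t"] by (simp add: state_payoff_def rejection_payoff_responder)
    next
      case (reject w)
      then show ?thesis
        using pos[of "responder ?t"]
        by (simp add: state_payoff_rejected) (simp add: state_payoff_def rejection_payoff_responder)
    next
      case continue
      then show ?thesis
        using pos[of m] choosing_may_switch[OF h] V_nonneg
        by (auto simp: state_payoff_def choosing_payoff_def match_payoff_def player_def may_switch_def)
    next
      case switch
      then show ?thesis
        using pos[of m] choosing_may_switch[OF h] V_nonneg
        by (auto simp: state_payoff_def choosing_payoff_def match_payoff_def player_def may_switch_def)
    qed
  qed
  show "\<exists>n. legal_moves G ((next_history G \<tau> ^^ n) h) = {} \<or>
      0 \<le> state_payoff V (st ((next_history G \<tau> ^^ n) h)) i"
    if \<tau>: "strategy_profile G \<tau>" and h: "h \<in> histories G" for \<tau> h i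
  proof -
    obtain n where n: "let x = stage (st ((next_history G \<tau> ^^ n) h)) in x = Offering \<or> stage_moves x = {}"
      using infinitely_often_offering[OF \<tau> h] by blast
    let ?h = "(next_history G \<tau> ^^ n) h"
    \<comment> \<open>At an offering stage the candidate value is a positive factor times a value of
      \<open>V\<close>, hence nonnegative for every player.\<close>
    have "0 \<le> match_payoff m (st ?h) (V (period (st ?h))) i"
      using factor_pos[OF funpow_in_histories[OF \<tau> h], of n] V_nonneg
      by (simp add: match_payoff_def less_imp_le)
    with n show ?thesis
      by (intro exI[of _ n]) (auto simp: Let_def state_payoff_def)
  qed
qed

lemma equilibrium_agreed_wage:
  assumes "gain Worker w = V 0 Worker"
  shows "agreed_wage m T \<delta> gain (\<lambda>h. equilibrium_move V (st h)) w"
proof -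
  let ?\<sigma> = "\<lambda>h. equilibrium_move V (st h)"
  have "(SOME x. gain Worker x = V 0 Worker) = w"
    using assms gain_bij by (auto intro!: some_equality simp: bij_def inj_def)
  then have "?\<sigma> [] = Offer w"
    by (simp add: equilibrium_move_def)
  moreover from this have "(next_history G ?\<sigma> ^^ 2) [] = [Accept, Offer w]"
    using assms by (simp add: numeral_2_eq_2 next_history_def equilibrium_move_def after_move_simps Let_def)
  ultimately have "ends_at G ?\<sigma> [] [Accept, Offer w]"
    unfolding ends_at_def by (metis legal_moves_G after_move_simps(1,2) game_state.select_convs(3)
        game_state.surjective game_state.update_convs(3) stage_moves.simps(4) state_at.simps)
  then show ?thesis
    unfolding agreed_wage_def by (auto simp: after_move_simps)
qed

end

end

lemma next_period_stage [simp]: "next_period \<delta> (s\<lparr>stage := x\<rparr>) = next_period \<delta> s"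
  by (simp add: next_period_def Let_def)

lemma new_match_stage [simp]: "new_match m (s\<lparr>stage := x\<rparr>) = new_match m s"
  by (simp add: new_match_def)

section \<open>Uniqueness of equilibrium payoffs\<close>

locale bargaining_equilibrium = wage_bargaining +
  fixes \<sigma> :: "move list \<Rightarrow> move"
  assumes spe: "subgame_perfect (bargaining_game m T \<delta> gain) \<sigma>"
begin

lemma profile: "strategy_profile G \<sigma>"
  using spe by (simp add: subgame_perfect_def)

text \<open>
  A player who asks for a gain of 0 and rejects every offer secures a payoff of 0.
\<close>

lemma offering_payoff_nonneg:
  assumes h: "h \<in> histories G" "stage (st h) = Offering"
  shows "0 \<le> play_payoff G \<sigma> h i"
proof -
  define \<tau> where "\<tau> h' = (if mover G h' = i then
      (case stage (st h') of
         Offering \<Rightarrow> Offer (SOME x. gain (fst i) x = 0)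
       | Responding _ \<Rightarrow> Reject
       | Choosing \<Rightarrow> Continue
       | Agreed _ \<Rightarrow> Accept) else \<sigma> h')" for h'
  have \<tau>: "strategy_profile G \<tau>"
    using profile by (auto simp: strategy_profile_def \<tau>_def simp del: mover_G split: stage.splits)
  have zero: "gain d (SOME x. gain d x = 0) = 0" for d
    using someI_ex[OF gain_surj] .
  \<comment> \<open>Under \<open>\<tau>\<close> the player \<open>i\<close> never accepts, so an
    agreement that involves \<open>i\<close> was proposed by \<open>i\<close> and gives it a gain of
    0; any other agreement pays it 0 as an outsider.\<close>
  define J where "J h' \<longleftrightarrow> (case stage (st h') of
      Responding w \<Rightarrow> i = party h' (proposer (period (st h'))) \<longrightarrow> gain (fst i) w = 0
    | Agreed w \<Rightarrow> match_payoff m (st h') (\<lambda>d. gain d w) i = 0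
    | _ \<Rightarrow> True)" for h'
  have step: "J (\<tau> h' # h')" if J: "J h'" and move: "\<tau> h' \<in> stage_moves (stage (st h'))" for h'
    using move
  proof (cases rule: stage_move_cases[where m = m and T = T and \<delta> = \<delta>])
    case (offer w)
    have "w = (SOME x. gain (fst i) x = 0)" if "i = party h' (proposer (period (st h')))"
      using offer(1,2) that by (simp add: \<tau>_def)
    then show ?thesis
      using zero offer(1,3) by (auto simp: J_def simp del: fst_player)
  next
    case (accept w)
    have "i \<noteq> party h' (responder (period (st h')))"
    proof
      assume "i = party h' (responder (period (st h')))"
      with accept(1,2) show False by (simp add: \<tau>_def)
    qed
    then have "fst i = proposer (period (st h'))" if "i = party h' (fst i)"
      using that not_side_eq[of "fst i" "responder (period (st h'))"] other_side_responder by metis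
    moreover have "i = party h' (proposer (period (st h'))) \<longrightarrow> gain (fst i) w = 0"
      using J accept(1) by (simp add: J_def)
    ultimately have "match_payoff m (st h') (\<lambda>d. gain d w) i = 0"
      unfolding match_payoff_def by (metis mult_zero_right)
    then show ?thesis
      using accept(1,3) by (simp add: J_def)
  qed (auto simp: J_def rejected_def)
  have J: "J ((next_history G \<tau> ^^ n) h)" for n
  proof (induction n)
    case 0
    then show ?case using h by (simp add: J_def)
  next
    case (Suc n)
    let ?h = "(next_history G \<tau> ^^ n) h"
    show ?case
    proof (cases "stage_moves (stage (st ?h)) = {}")
      case True
      then have "next_history G \<tau> ?h = ?h"
        by (intro next_history_terminal) simp
      with Suc show ?thesis
        by (simp only: funpow.simps o_apply)
    next
      case False
      then have "\<tau> ?h \<in> stage_moves (stage (st ?h))"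
        using \<tau> funpow_in_histories[OF \<tau> h(1), of n] by (auto simp: strategy_profile_def)
      then have "J (\<tau> ?h # ?h)"
        by (rule step[OF Suc])
      moreover have "next_history G \<tau> ?h = \<tau> ?h # ?h"
        using False by (intro next_history_move) simp
      ultimately show ?thesis
        by (simp only: funpow.simps o_apply)
    qed
  qed
  have "0 \<le> play_payoff G \<tau> h i"
  proof (cases "\<exists>z. ends_at G \<tau> h z")
    case True
    then obtain z where z: "ends_at G \<tau> h z" by blast
    then obtain n w where n: "z = (next_history G \<tau> ^^ n) h" and w: "stage (st z) = Agreed w"
      by (auto simp: ends_at_def terminal_iff)
    then show ?thesis
      using J[of n] by (simp add: play_payoff_ends_at[OF z] utility_G J_def)
  next
    case False
    then show ?thesis by (simp add: play_payoff_def)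
  qed
  also have "play_payoff G \<tau> h i \<le> play_payoff G \<sigma> h i"
  proof -
    have "\<forall>h'. mover G h' \<noteq> i \<longrightarrow> \<tau> h' = \<sigma> h'"
      by (simp add: \<tau>_def)
    then show ?thesis
      using spe h(1) \<tau> unfolding subgame_perfect_def by blast
  qed
  finally show ?thesis .
qed

text \<open>Payoffs are constant along the play and nonnegative at each offering stage; a new
  partner enters at such a stage, so its gain is nonnegative as well. A partner's factor is reset to
  1 by a switch, which is why the bound for both sides needs the match to be the same.\<close>

lemma agreement:
  assumes h: "h \<in> histories G" "stage (st h) = Offering"
    and z: "ends_at G \<sigma> h z" and w: "stage (st z) = Agreed w"
  shows "0 \<le> gain s w" and "factor (st z) m \<le> factor (st h) m"
    and "match (st z) = match (st h) \<Longrightarrow> factor (st z) s \<le> factor (st h) s"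
    and "z \<in> histories G"
proof -
  \<comment> \<open>The clause that match numbers do not fall below the initial one makes the last
    clause vacuous after a switch.\<close>
  define I where "I h' \<longleftrightarrow>
    (\<forall>s. 0 \<le> play_payoff G \<sigma> h' (party h' s)) \<and> factor (st h') m \<le> factor (st h) m \<and>
    match (st h) \<le> match (st h') \<and>
    (match (st h') = match (st h) \<longrightarrow> (\<forall>s. factor (st h') s \<le> factor (st h) s))" for h'
  have I: "I ((next_history G \<sigma> ^^ n) h)" for n
  proof (induction n)
    case 0
    then show ?case using h offering_payoff_nonneg by (simp add: I_def)
  next
    case (Suc n)
    let ?h = "(next_history G \<sigma> ^^ n) h"
    show ?case
    proof (cases "stage_moves (stage (st ?h)) = {}")
      case True
      then have "next_history G \<sigma> ?h = ?h"
        by (intro next_history_terminal) simp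
      with Suc show ?thesis
        by (simp only: funpow.simps o_apply)
    next
      case False
      have hist: "?h \<in> histories G" by (rule funpow_in_histories[OF profile h(1)])
      then have move: "\<sigma> ?h \<in> stage_moves (stage (st ?h))"
        using False profile by (auto simp: strategy_profile_def)
      have pay: "play_payoff G \<sigma> (\<sigma> ?h # ?h) = play_payoff G \<sigma> ?h"
        using False by (intro ext play_payoff_move) simp
      have hist': "\<sigma> ?h # ?h \<in> histories G"
        using hist move by (auto intro: histories.move)
      have shrink: "\<delta> d * factor (st ?h) d \<le> factor (st h) d"
        if "factor (st ?h) d \<le> factor (st h) d" for d
      proof -
        have "\<delta> d * factor (st ?h) d \<le> factor (st ?h) d"
          using factor_pos[OF hist, of d] discount_less_1[of d] discount_pos[of d]
          by (simp add: mult_left_le_one_le)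
        with that show ?thesis by simp
      qed
      have nonneg: "0 \<le> play_payoff G \<sigma> ?h i" if "stage (st (\<sigma> ?h # ?h)) = Offering" for i
        using offering_payoff_nonneg[OF hist' that] by (simp add: pay)
      from move have "I (\<sigma> ?h # ?h)"
      proof (cases rule: stage_move_cases[where m = m and T = T and \<delta> = \<delta>])
        case (offer w)
        from offer(1,3) show ?thesis
          using Suc by (auto simp: I_def pay)
      next
        case (accept w)
        from accept(1,3) show ?thesis
          using Suc by (auto simp: I_def pay)
      next
        case (reject w)
        from reject(1,3) show ?thesis
          using Suc shrink nonneg by (auto simp: I_def pay rejected_def)
      next
        case continue
        from continue(1,3) show ?thesis
          using Suc shrink nonneg by (auto simp: I_def pay)
      next
        case switch
        from switch(1,3) show ?thesis
          using Suc nonneg by (auto simp: I_def pay)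
      qed
      moreover have "next_history G \<sigma> ?h = \<sigma> ?h # ?h"
        using False by (intro next_history_move) simp
      ultimately show ?thesis
        by (simp only: funpow.simps o_apply)
    qed
  qed
  obtain n where n: "z = (next_history G \<sigma> ^^ n) h"
    using z by (auto simp: ends_at_def)
  show hist: "z \<in> histories G"
    unfolding n by (rule funpow_in_histories[OF profile h(1)])
  have "play_payoff G \<sigma> z i = utility G i z" for i
    using w by (intro play_payoff_terminal) simp
  moreover have "0 \<le> play_payoff G \<sigma> z (party z s)"
    using I[of n] by (simp add: I_def n)
  ultimately have "0 \<le> factor (st z) s * gain s w"
    by (simp add: utility_G[OF w])
  then show "0 \<le> gain s w"
    using factor_pos[OF hist, of s] by (simp add: zero_le_mult_iff)
  show "factor (st z) m \<le> factor (st h) m"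
    "match (st z) = match (st h) \<Longrightarrow> factor (st z) s \<le> factor (st h) s"
    using I[of n] by (auto simp: I_def n)
qed

text \<open>Removing the accumulated factor makes payoffs comparable with \<open>V\<close>, which
  depends on the period only.\<close>

definition normalized_payoff :: "move list \<Rightarrow> side \<Rightarrow> real" where
  "normalized_payoff h s = play_payoff G \<sigma> h (party h s) / factor (st h) s"

lemma play_payoff_normalized:
  "h \<in> histories G \<Longrightarrow>
    play_payoff G \<sigma> h (party h s) = factor (st h) s * normalized_payoff h s"
  using factor_pos[of h s] by (simp add: normalized_payoff_def)

lemma normalized_payoff_nonneg:
  "h \<in> histories G \<Longrightarrow> stage (st h) = Offering \<Longrightarrow> 0 \<le> normalized_payoff h s"
  using offering_payoff_nonneg factor_pos by (simp add: normalized_payoff_def less_imp_le)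

text \<open>Within the same match factors only shrink, so the sum is at most the sum of the gains.
  After a switch the abandoned partner has 0, and \<open>m\<close> gets at most its gain, which is
  at most \<open>S\<close> because the new partner's gain is nonnegative.\<close>

lemma normalized_payoff_sum:
  assumes "0 \<le> S" and h: "h \<in> histories G" "stage (st h) = Offering"
  shows "normalized_payoff h s + normalized_payoff h (other_side s) \<le> S"
proof (cases "\<exists>z. ends_at G \<sigma> h z")
  case False
  then show ?thesis
    using assms(1) by (simp add: normalized_payoff_def play_payoff_def)
next
  case True
  then obtain z where z: "ends_at G \<sigma> h z" by blast
  then obtain w where w: "stage (st z) = Agreed w"
    by (auto simp: ends_at_def terminal_iff)
  note * = agreement[OF h z w]
  have pay: "play_payoff G \<sigma> h i = match_payoff m (st z) (\<lambda>s. gain s w) i" for i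
    by (simp add: play_payoff_ends_at[OF z] utility_G[OF w])
  have le: "normalized_payoff h d \<le> gain d w" if "match (st z) = match (st h) \<or> d = m" for d
  proof -
    have "factor (st z) d * gain d w \<le> factor (st h) d * gain d w"
      using that *(1)[of d] *(2) *(3)[of d] by (intro mult_right_mono) auto
    moreover have "party h d = party z d"
      using that by (auto simp: player_def)
    ultimately show ?thesis
      using factor_pos[OF h(1), of d] by (simp add: normalized_payoff_def pay pos_divide_le_eq mult.commute)
  qed
  have "normalized_payoff h m + normalized_payoff h (other_side m) \<le> S"
  proof (cases "match (st z) = match (st h)")
    case True
    then show ?thesis
      using le[of m] le[of "other_side m"] gain_other[of m w] by simp
  next
    case False
    then have "normalized_payoff h (other_side m) = 0"
      by (simp add: normalized_payoff_def pay match_payoff_def player_def)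
    then show ?thesis
      using le[of m] *(1)[of "other_side m"] gain_other[of m w] by simp
  qed
  then show ?thesis
    using not_side_eq[of s m] by (cases "s = m") (auto simp: add.commute)
qed

text \<open>
  The responder's value of rejecting pins down both payoffs: the proposer can offer slightly more
  than the largest such value and is sure of acceptance.
\<close>

lemma offering_bounds:
  assumes "0 \<le> S" and h: "h \<in> histories G" "stage (st h) = Offering"
    and v: "v (proposer (period (st h))) = S - v (responder (period (st h)))"
    and reject: "\<And>x. \<bar>play_payoff G \<sigma> (Reject # Offer x # h) (party h (responder (period (st h))))
        / factor (st h) (responder (period (st h))) - v (responder (period (st h)))\<bar> \<le> d"
  shows "\<bar>normalized_payoff h s - v s\<bar> \<le> d"
proof -
  define r where "r = responder (period (st h))"
  define p where "p = proposer (period (st h))"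
  have rp: "other_side r = p" "other_side p = r"
    by (simp_all add: r_def p_def)
  note pos = factor_pos[OF h(1)]
  have hx: "Offer x # h \<in> histories G" for x
    using h by (auto intro: histories.move)
  have stx: "st (Offer x # h) = (st h)\<lparr>stage := Responding x\<rparr>" for x
    using h by (simp add: after_move_simps)
  have sta: "st (Accept # Offer x # h) = (st h)\<lparr>stage := Agreed x\<rparr>" for x
    using h by (simp add: after_move_simps)
  have accept_pay: "play_payoff G \<sigma> (Accept # Offer x # h) (party h d) = factor (st h) d * gain d x" for x d
  proof -
    have "play_payoff G \<sigma> (Accept # Offer x # h) i = utility G i (Accept # Offer x # h)" for i
      using sta by (intro play_payoff_terminal) simp
    then show ?thesis
      using sta[of x] by (simp add: utility_G)
  qed
  have respond: "play_payoff G \<sigma> (a # Offer x # h) (party h r) \<le> play_payoff G \<sigma> (Offer x # h) (party h r)"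
    if "a \<in> {Accept, Reject}" for a x
    using subgame_perfect_deviation[OF spe hx, of a x] that
    by (simp add: stx r_def del: state_at.simps)
  have offer: "play_payoff G \<sigma> (Offer x # h) (party h p) \<le> play_payoff G \<sigma> h (party h p)" for x
    using subgame_perfect_deviation[OF spe h(1), of "Offer x"] h(2) by (simp add: p_def)
  have responder_ge: "v r - d \<le> normalized_payoff h r"
  proof -
    have "\<sigma> h \<in> range Offer"
      using profile h by (auto simp: strategy_profile_def)
    then obtain x where x: "\<sigma> h = Offer x" by blast
    have "play_payoff G \<sigma> (Offer x # h) = play_payoff G \<sigma> h"
      using play_payoff_move[of G h \<sigma>] x h(2) by auto
    then have "play_payoff G \<sigma> (Reject # Offer x # h) (party h r) / factor (st h) r \<le> normalized_payoff h r"
      using respond[of Reject x] pos[of r] by (simp add: normalized_payoff_def divide_right_mono)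
    then show ?thesis
      using reject[of x] by (simp add: r_def)
  qed
  have proposer_ge: "S - v r - d \<le> normalized_payoff h p"
  proof (rule field_le_epsilon)
    fix \<epsilon> :: real assume "0 < \<epsilon>"
    \<comment> \<open>The surplus \<open>\<epsilon>\<close> makes acceptance strictly better than
      any rejection; at equality \<open>\<sigma>\<close> might reject.\<close>
    obtain x where x: "gain r x = v r + d + \<epsilon>"
      using gain_surj by blast
    have "play_payoff G \<sigma> (Reject # Offer x # h) (party h r) / factor (st h) r \<le> v r + d"
      using reject[of x] by (simp add: r_def)
    then have "play_payoff G \<sigma> (Reject # Offer x # h) (party h r) \<le> factor (st h) r * (v r + d)"
      using pos[of r] by (simp add: field_simps)
    also have "\<dots> < factor (st h) r * gain r x"
      using \<open>0 < \<epsilon>\<close> pos[of r] x by simp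
    also have "\<dots> \<le> play_payoff G \<sigma> (Offer x # h) (party h r)"
      using respond[of Accept x] by (simp add: accept_pay)
    finally have less: "play_payoff G \<sigma> (Reject # Offer x # h) (party h r) <
        play_payoff G \<sigma> (Offer x # h) (party h r)" .
    have moves: "legal_moves G (Offer x # h) = {Accept, Reject}"
      by (simp add: stx del: state_at.simps)
    then have "\<sigma> (Offer x # h) \<in> {Accept, Reject}"
      using profile hx[of x] by (auto simp: strategy_profile_def)
    moreover have same: "play_payoff G \<sigma> (\<sigma> (Offer x # h) # Offer x # h) i = play_payoff G \<sigma> (Offer x # h) i" for i
      using moves by (intro play_payoff_move) simp
    ultimately have "\<sigma> (Offer x # h) = Accept"
      using less by (metis insertE less_irrefl singletonD)
    with same have "play_payoff G \<sigma> (Offer x # h) (party h p) = factor (st h) p * gain p x"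
      using accept_pay by metis
    then have "factor (st h) p * gain p x \<le> factor (st h) p * normalized_payoff h p"
      using offer[of x] play_payoff_normalized[OF h(1), of p] by simp
    then have "gain p x \<le> normalized_payoff h p"
      using pos[of p] by simp
    then show "S - v r - d \<le> normalized_payoff h p + \<epsilon>"
      using gain_other[of r x] x rp by simp
  qed
  \<comment> \<open>The sum bound converts the two lower bounds into upper bounds, each of them for
    the other side.\<close>
  have "normalized_payoff h r + normalized_payoff h p \<le> S"
    using normalized_payoff_sum[OF assms(1) h, of r] rp by simp
  moreover have "s = r \<or> s = p"
    using not_side_eq[of s r] rp by auto
  ultimately show ?thesis
    using responder_ge proposer_ge v by (auto simp: r_def[symmetric] p_def[symmetric])
qed

end

section \<open>Contraction toward the candidate values\<close>

locale bargaining_equilibrium_values = bargaining_equilibrium +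
  fixes V :: "nat \<Rightarrow> side \<Rightarrow> real"
  assumes V: "equilibrium_values V" and nonneg: "0 \<le> S"
    and no_switch_0: "\<not> may_switch m T 0"
begin

text \<open>Uniform over all histories, since \<open>\<sigma>\<close> need not be stationary: play
  after a rejection may depend on the wage rejected.\<close>

definition approximates :: "real \<Rightarrow> bool" where
  "approximates e \<longleftrightarrow> (\<forall>h \<in> histories G. stage (st h) = Offering \<longrightarrow>
     (\<forall>s. \<bar>normalized_payoff h s - V (period (st h)) s\<bar> \<le> e))"

text \<open>Two error bounds are needed. Continuing discounts the error \<open>e\<close>, so that it
  falls to \<open>d\<close>; switching discounts nothing, so period 0 must already have the error
  \<open>d\<close>. That is asked only where a switch is possible, hence not at period 0
  itself.\<close>

lemma rejection_bound:
  assumes h: "h \<in> histories G" "stage (st h) = Offering"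
    and e: "approximates e"
    and e0: "\<And>h'. may_switch m T (period (st h)) \<Longrightarrow> h' \<in> histories G \<Longrightarrow>
      stage (st h') = Offering \<Longrightarrow> period (st h') = 0 \<Longrightarrow> \<bar>normalized_payoff h' m - V 0 m\<bar> \<le> d"
    and d: "\<delta> (responder (period (st h))) * e \<le> d"
  shows "\<bar>play_payoff G \<sigma> (Reject # Offer x # h) (party h (responder (period (st h))))
        / factor (st h) (responder (period (st h))) - V (period (st h)) (responder (period (st h)))\<bar> \<le> d"
proof -
  define t where "t = period (st h)"
  define r where "r = responder t"
  define h2 where "h2 = Reject # Offer x # h"
  note pos = factor_pos[OF h(1)]
  have st2: "st h2 = (if may_switch m T t then (st h)\<lparr>stage := Choosing\<rparr> else next_period \<delta> (st h))"
    using h by (simp add: h2_def after_move_simps rejected_def t_def)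
  have h2: "h2 \<in> histories G"
    using h by (auto simp: h2_def after_move_simps intro!: histories.move)
  have later: "\<bar>play_payoff G \<sigma> h3 (party h r) / factor (st h) r - \<delta> r * V (Suc t) r\<bar> \<le> d"
    if "h3 \<in> histories G" and st3: "st h3 = next_period \<delta> (st h)" for h3
  proof -
    have "party h3 r = party h r" "factor (st h3) r = \<delta> r * factor (st h) r"
      by (simp_all add: st3 r_def t_def)
    then have "play_payoff G \<sigma> h3 (party h r) / factor (st h) r = \<delta> r * normalized_payoff h3 r"
      using play_payoff_normalized[OF that(1), of r] pos[of r] by simp
    moreover have "\<bar>normalized_payoff h3 r - V (Suc t) r\<bar> \<le> e"
      using e that by (auto simp: approximates_def t_def)
    then have "\<delta> r * \<bar>normalized_payoff h3 r - V (Suc t) r\<bar> \<le> \<delta> r * e"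
      by (intro mult_left_mono) (auto simp: discount_pos less_imp_le)
    moreover have "\<bar>\<delta> r * normalized_payoff h3 r - \<delta> r * V (Suc t) r\<bar> =
        \<delta> r * \<bar>normalized_payoff h3 r - V (Suc t) r\<bar>"
      using discount_pos[of r] by (simp add: abs_mult right_diff_distrib[symmetric])
    moreover have "\<delta> r * e \<le> d"
      using d by (simp add: r_def t_def)
    ultimately show ?thesis
      by linarith
  qed
  have "\<bar>play_payoff G \<sigma> h2 (party h r) / factor (st h) r - V t r\<bar> \<le> d"
  proof (cases "may_switch m T t")
    case False
    then show ?thesis
      using later[OF h2] st2 V_responder[OF V, of t] by (simp add: r_def)
  next
    case True
    then have rm: "r = m"
      by (simp add: r_def may_switch_responder)
    define c where "c = play_payoff G \<sigma> (Continue # h2) (party h m)"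
    define b where "b = play_payoff G \<sigma> (Switch # h2) (party h m)"
    have stage2: "stage (st h2) = Choosing"
      using True st2 by simp
    have stc: "st (Continue # h2) = next_period \<delta> (st h)" and sts: "st (Switch # h2) = new_match m (st h)"
      using stage2 True st2 by (simp_all add: after_move_simps)
    have hc: "Continue # h2 \<in> histories G" and hs: "Switch # h2 \<in> histories G"
      using h2 stage2 by (auto intro: histories.move)
    have mover2: "mover G h2 = party h m"
      using True st2 rm by (simp add: r_def t_def)
    have "c \<le> play_payoff G \<sigma> h2 (party h m)" "b \<le> play_payoff G \<sigma> h2 (party h m)"
      using subgame_perfect_deviation[OF spe h2] stage2
      unfolding mover2 by (auto simp: b_def c_def)
    moreover have "play_payoff G \<sigma> h2 (party h m) \<in> {c, b}"
    proof -
      have "\<sigma> h2 \<in> {Continue, Switch}"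
        using profile h2 stage2 by (auto simp: strategy_profile_def)
      moreover have same: "play_payoff G \<sigma> (\<sigma> h2 # h2) (party h m) = play_payoff G \<sigma> h2 (party h m)"
        using stage2 by (intro play_payoff_move) simp
      ultimately show ?thesis
        unfolding b_def c_def same[symmetric] by (elim insertE emptyE) simp_all
    qed
    ultimately have "play_payoff G \<sigma> h2 (party h m) = max c b"
      by auto
    then have "play_payoff G \<sigma> h2 (party h m) / factor (st h) m = max (c / factor (st h) m) (b / factor (st h) m)"
      using pos[of m] by (auto simp: max_def divide_le_cancel)
    moreover have "\<bar>c / factor (st h) m - \<delta> m * V (Suc t) m\<bar> \<le> d"
      using later[OF hc stc] rm by (simp add: c_def)
    moreover have "\<bar>b / factor (st h) m - V 0 m\<bar> \<le> d"
    proof -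
      have "party (Switch # h2) m = party h m"
        by (simp add: sts player_def del: state_at.simps)
      then have "b / factor (st h) m = normalized_payoff (Switch # h2) m"
        by (simp add: b_def normalized_payoff_def sts del: state_at.simps)
      then show ?thesis
        using e0[OF _ hs] True by (simp add: sts t_def del: state_at.simps)
    qed
    moreover have "V t m = max (\<delta> m * V (Suc t) m) (V 0 m)"
      using V_responder[OF V, of t] True rm by (simp add: r_def)
    \<comment> \<open>A maximum changes by at most \<open>d\<close> if both of its arguments
      do.\<close>
    ultimately show ?thesis
      using rm by auto
  qed
  then show ?thesis
    by (simp add: r_def t_def h2_def)
qed

lemma approximates_contract:
  assumes e: "approximates e" "0 \<le> e"
  shows "approximates (max (\<delta> Firm) (\<delta> Worker) * e)"
proof -
  let ?d = "max (\<delta> Firm) (\<delta> Worker) * e"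
  have d: "\<delta> s * e \<le> ?d" for s
    using e(2) by (cases s) (auto intro!: mult_right_mono)
  have period_0: "\<bar>normalized_payoff h s - V (period (st h)) s\<bar> \<le> ?d"
    if h: "h \<in> histories G" "stage (st h) = Offering" "period (st h) = 0" for h s
  proof (rule offering_bounds[OF nonneg h(1,2) V_proposer[OF V]])
    fix x
    show "\<bar>play_payoff G \<sigma> (Reject # Offer x # h) (party h (responder (period (st h)))) /
        factor (st h) (responder (period (st h))) - V (period (st h)) (responder (period (st h)))\<bar> \<le> ?d"
      by (rule rejection_bound[OF h(1,2) e(1) _ d]) (use no_switch_0 h(3) in simp)
  qed
  show ?thesis
    unfolding approximates_def
  proof (intro ballI impI allI)
    fix h s
    assume h: "h \<in> histories G" "stage (st h) = Offering"
    show "\<bar>normalized_payoff h s - V (period (st h)) s\<bar> \<le> ?d"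
    proof (rule offering_bounds[OF nonneg h V_proposer[OF V]])
      fix x
      show "\<bar>play_payoff G \<sigma> (Reject # Offer x # h) (party h (responder (period (st h)))) /
          factor (st h) (responder (period (st h))) - V (period (st h)) (responder (period (st h)))\<bar> \<le> ?d"
        by (rule rejection_bound[OF h e(1) _ d]) (use period_0[of _ m] in metis)
    qed
  qed
qed

lemma normalized_payoff_eq:
  assumes h: "h \<in> histories G" "stage (st h) = Offering"
  shows "normalized_payoff h s = V (period (st h)) s"
proof -
  let ?\<kappa> = "max (\<delta> Firm) (\<delta> Worker)"
  have \<kappa>: "0 \<le> ?\<kappa>" "?\<kappa> < 1"
    using discount_pos[of Firm] discount_less_1[of Firm] discount_less_1[of Worker] by simp_all
  have "approximates (?\<kappa> ^ n * S)" for n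
  proof (induction n)
    case 0
    \<comment> \<open>Both numbers lie between 0 and \<open>S\<close>: the values by definition, the
      payoffs by nonnegativity on both sides and the bound on their sum.\<close>
    have "\<bar>normalized_payoff h s - V (period (st h)) s\<bar> \<le> S"
      if "h \<in> histories G" "stage (st h) = Offering" for h s
      using normalized_payoff_nonneg[OF that, of s] normalized_payoff_nonneg[OF that, of "other_side s"]
        normalized_payoff_sum[OF nonneg that, of s]
        V_nonneg[OF V, of "period (st h)" s] V_nonneg[OF V, of "period (st h)" "other_side s"]
        V_other[OF V, of "period (st h)" s]
      by linarith
    then show ?case by (simp add: approximates_def)
  next
    case (Suc n)
    have "approximates (?\<kappa> * (?\<kappa> ^ n * S))"
      by (rule approximates_contract[OF Suc]) (intro mult_nonneg_nonneg zero_le_power \<kappa> nonneg)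
    then show ?case
      by (simp only: power_Suc mult.assoc)
  qed
  then have bound: "\<bar>normalized_payoff h s - V (period (st h)) s\<bar> \<le> ?\<kappa> ^ n * S" for n
    using h unfolding approximates_def by blast
  have "(\<lambda>n. ?\<kappa> ^ n * S) \<longlonglongrightarrow> 0"
    using \<kappa> by (intro tendsto_mult_left_zero LIMSEQ_power_zero) simp
  then have "\<bar>normalized_payoff h s - V (period (st h)) s\<bar> \<le> 0"
    by (rule LIMSEQ_le_const) (intro exI allI impI bound)
  then show ?thesis by simp
qed

end

context bargaining_equilibrium
begin

text \<open>This is what later excludes reservation values above \<open>y\<close>.\<close>

lemma agreed_surplus_nonneg:
  assumes "agreed_wage m T \<delta> gain \<sigma> w"
  shows "0 \<le> S"
proof -
  obtain z where "ends_at G \<sigma> [] z" "stage (st z) = Agreed w"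
    using assms by (auto simp: agreed_wage_def)
  from agreement(1)[OF _ _ this] show ?thesis
    using gain_sum[of w] by (simp add: histories.root) (metis add_nonneg_nonneg)
qed

text \<open>If \<open>0 < S\<close>, both values are positive. Were the agreement in a later match,
  the first partner would get 0; so it is in match 0, where factors are at most 1 and each gain is
  at least the corresponding value. Both pairs sum to \<open>S\<close>, which forces equality. If
  \<open>S = 0\<close>, all gains and values vanish.\<close>

theorem agreed_wage_unique:
  assumes V: "equilibrium_values V" and "\<not> may_switch m T 0"
    and interior: "0 < S \<Longrightarrow> 0 < V 0 Worker \<and> V 0 Worker < S"
    and wage: "agreed_wage m T \<delta> gain \<sigma> w"
  shows "gain Worker w = V 0 Worker"
proof -
  have S: "0 \<le> S"
    by (rule agreed_surplus_nonneg[OF wage])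
  interpret bargaining_equilibrium_values m T \<delta> gain S \<sigma> V
    by unfold_locales (fact V S assms(2))+
  have root: "[] \<in> histories G" "stage (st []) = Offering"
    by (simp_all add: histories.root)
  obtain z where z: "ends_at G \<sigma> [] z" and w: "stage (st z) = Agreed w"
    using wage by (auto simp: agreed_wage_def)
  note * = agreement[OF root z w]
  show ?thesis
  proof (cases "S = 0")
    case True
    then show ?thesis
      using *(1)[of Firm] *(1)[of Worker] gain_sum[of w] V_nonneg[OF V, of 0 Firm]
        V_nonneg[OF V, of 0 Worker] V_other[OF V, of 0 Firm] by simp
  next
    case False
    have V0: "0 < V 0 s" for s
      using False S interior V_other[OF V, of 0 Worker] by (cases s) auto
    have pay: "match_payoff m (st z) (\<lambda>s. gain s w) (player m 0 s) = V 0 s" for s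
      using normalized_payoff_eq[OF root, of s] play_payoff_ends_at[OF z]
      by (simp add: normalized_payoff_def utility_G[OF w])
    have "match (st z) = 0"
      using pay[of "other_side m"] V0[of "other_side m"]
      by (auto simp: match_payoff_def player_def split: if_splits)
    then have "V 0 s \<le> gain s w" for s
      using pay[of s] *(1,3)[of s] match_payoff_player[of m "st z" _ s]
      by (simp add: mult_left_le_one_le factor_pos[OF *(4)] less_imp_le flip: pay)
    then show ?thesis
      using gain_sum[of w] V_other[OF V, of 0 Worker] by (smt (verit) other_side.simps)
  qed
qed

end

section \<open>Exponential waiting times\<close>

lemma nn_integral_exponential_density_atLeast:
  assumes "0 < l" "0 \<le> x"
  shows "(\<integral>\<^sup>+y. ennreal (exponential_density l y) * indicator {x..} y \<partial>lborel) = ennreal (exp (- l * x))"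
proof -
  have "(\<integral>\<^sup>+y. ennreal (exponential_density l y) * indicator {x..} y \<partial>lborel) =
      (\<integral>\<^sup>+y. ennreal (l * exp (- l * y)) * indicator {x..} y \<partial>lborel)"
    using assms by (intro nn_integral_cong) (auto simp: exponential_density_def indicator_def mult_ac)
  also have "\<dots> = ennreal (0 - (- exp (- l * x)))"
  proof (rule nn_integral_FTC_atLeast)
    show "DERIV (\<lambda>y. - exp (- l * y)) y :> l * exp (- l * y)" for y
      by (auto intro!: derivative_eq_intros)
    have "filterlim (\<lambda>y. - l * y) at_bot at_top"
      using assms(1) by (intro filterlim_tendsto_neg_mult_at_bot[OF tendsto_const] filterlim_ident) auto
    then have "((\<lambda>y. - exp (- l * y)) \<longlongrightarrow> - 0) at_top"
      by (intro tendsto_minus filterlim_compose[OF exp_at_bot])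
    then show "((\<lambda>y. - exp (- l * y)) \<longlongrightarrow> 0) at_top" by simp
  qed (use assms in auto)
  finally show ?thesis by simp
qed

text \<open>Integrating out \<open>Y\<close> over \<open>{x..}\<close> leaves
  \<open>l * exp (- (l + u) * x)\<close>, which is \<open>l / (l + u)\<close> times the exponential
  density of rate \<open>l + u\<close>.\<close>

lemma (in prob_space) exponential_race:
  assumes l: "0 < l" and u: "0 < u"
    and X: "distributed M lborel X (exponential_density l)"
    and Y: "distributed M lborel Y (exponential_density u)"
    and indep: "indep_var borel X borel Y"
  shows "\<P>(\<omega> in M. X \<omega> \<le> Y \<omega>) = l / (l + u)"
proof -
  let ?A = "{p :: real \<times> real. fst p \<le> snd p}"
  let ?e = "\<lambda>l x. ennreal (exponential_density l x)"
  have "indep_var lborel X lborel Y"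
    using indep unfolding indep_var_eq by (simp add: measurable_lborel1 sets_lborel space_lborel)
  then have J: "distributed M (lborel \<Otimes>\<^sub>M lborel) (\<lambda>\<omega>. (X \<omega>, Y \<omega>)) (\<lambda>(x, y). ?e l x * ?e u y)"
    by (intro distributed_joint_indep X Y) (simp_all add: sigma_finite_lborel)
  have A: "?A \<in> sets (lborel \<Otimes>\<^sub>M lborel)"
  proof -
    have "{p \<in> space (borel \<Otimes>\<^sub>M borel). fst p \<le> snd p} \<in> sets (borel \<Otimes>\<^sub>M (borel :: real measure))"
      by measurable
    then have "?A \<in> sets (borel \<Otimes>\<^sub>M borel)"
      by (simp add: space_pair_measure)
    moreover have "sets (lborel \<Otimes>\<^sub>M lborel) = sets (borel \<Otimes>\<^sub>M (borel :: real measure))"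
      by (intro sets_pair_measure_cong) auto
    ultimately show ?thesis by simp
  qed
  have "emeasure M {\<omega> \<in> space M. X \<omega> \<le> Y \<omega>} =
      emeasure M ((\<lambda>\<omega>. (X \<omega>, Y \<omega>)) -` ?A \<inter> space M)"
    by (intro arg_cong[where f = "emeasure M"]) auto
  also have "\<dots> = (\<integral>\<^sup>+p. (case p of (x, y) \<Rightarrow> ?e l x * ?e u y) * indicator ?A p \<partial>(lborel \<Otimes>\<^sub>M lborel))"
    by (rule distributed_emeasure[OF J A])
  also have "\<dots> = (\<integral>\<^sup>+x. \<integral>\<^sup>+y. ?e l x * ?e u y * indicator ?A (x, y) \<partial>lborel \<partial>lborel)"
    using A by (subst lborel.nn_integral_fst[symmetric]) (auto simp: case_prod_unfold)
  also have "\<dots> = (\<integral>\<^sup>+x. ennreal (l / (l + u)) * ?e (l + u) x \<partial>lborel)"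
  proof (intro nn_integral_cong)
    fix x :: real
    have "(\<integral>\<^sup>+y. ?e l x * ?e u y * indicator ?A (x, y) \<partial>lborel) =
        ?e l x * (\<integral>\<^sup>+y. ?e u y * indicator {x..} y \<partial>lborel)"
      by (subst nn_integral_cmult[symmetric])
        (auto intro!: nn_integral_cong simp: indicator_def mult_ac)
    also have "\<dots> = ennreal (l / (l + u)) * ?e (l + u) x"
    proof (cases "x < 0")
      case False
      then have "?e l x * (\<integral>\<^sup>+y. ?e u y * indicator {x..} y \<partial>lborel) = ?e l x * ennreal (exp (- u * x))"
        using nn_integral_exponential_density_atLeast[OF u, of x] by simp
      also have "\<dots> = ennreal (l * exp (- x * l) * exp (- u * x))"
        using False l by (simp add: exponential_density_def ennreal_mult[symmetric])
      also have "l * exp (- x * l) * exp (- u * x) = l / (l + u) * ((l + u) * exp (- x * (l + u)))"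
        using l u by (simp add: exp_add[symmetric] algebra_simps add_divide_distrib[symmetric])
          (simp add: field_simps)
      also have "ennreal \<dots> = ennreal (l / (l + u)) * ?e (l + u) x"
        using False l u by (simp add: exponential_density_def ennreal_mult[symmetric])
      finally show ?thesis .
    qed (simp add: exponential_density_def)
    finally show "(\<integral>\<^sup>+y. ?e l x * ?e u y * indicator ?A (x, y) \<partial>lborel) =
        ennreal (l / (l + u)) * ?e (l + u) x" .
  qed
  also have "\<dots> = ennreal (l / (l + u)) * (\<integral>\<^sup>+x. ?e (l + u) x \<partial>lborel)"
    by (intro nn_integral_cmult) simp
  also have "(\<integral>\<^sup>+x. ?e (l + u) x \<partial>lborel) = 1"
    using prob_space.emeasure_space_1[OF prob_space_exponential_density[of "l + u"]] l u
    by (simp add: emeasure_density)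
  finally show ?thesis
    using l u by (simp add: emeasure_eq_measure)
qed

lemma average_wage_exponential:
  assumes "prob_space M" and "0 < l" "0 < u"
    and "distributed M lborel X (exponential_density l)"
    and "distributed M lborel Y (exponential_density u)"
    and "prob_space.indep_var M borel X borel Y"
  shows "average_wage M X Y v w = (l * v + u * w) / (l + u)"
proof -
  interpret prob_space M by fact
  have [measurable]: "random_variable borel X" "random_variable borel Y"
    using assms(4,5) by (auto dest: distributed_measurable)
  let ?A = "{\<omega> \<in> space M. X \<omega> \<le> Y \<omega>}"
  have "average_wage M X Y v w = (\<integral>\<omega>. w + (v - w) * indicator ?A \<omega> \<partial>M)"
    unfolding average_wage_def by (intro Bochner_Integration.integral_cong) (auto simp: indicator_def min_def)
  also have "\<dots> = w + (v - w) * prob ?A"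
    by (subst Bochner_Integration.integral_add) (auto simp: prob_space emeasure_eq_measure)
  also have "prob ?A = l / (l + u)"
    by (rule exponential_race[OF assms(2-6)])
  also have "w + (v - w) * (l / (l + u)) = (l * v + u * w) / (l + u)"
    using assms(2,3) by (simp add: field_simps)
  finally show ?thesis .
qed

section \<open>Explicit values and wages\<close>

text \<open>The responder's share in the stationary game without outside option: the fixed point of
  \<open>a = \<delta> Worker * (1 - \<delta> Firm * (1 - a))\<close>.\<close>

definition rubinstein_share :: "(side \<Rightarrow> real) \<Rightarrow> real" where
  "rubinstein_share \<delta> = \<delta> Worker * (1 - \<delta> Firm) / (1 - \<delta> Firm * \<delta> Worker)"

text \<open>
  The option of a switch is worthless to the worker, who would again be the responder in the first
  period of the new match.
\<close>

definition initial_worker_share :: "side \<Rightarrow> nat \<Rightarrow> (side \<Rightarrow> real) \<Rightarrow> real" where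
  "initial_worker_share m T \<delta> =
     (case m of
        Worker \<Rightarrow> rubinstein_share \<delta>
      | Firm \<Rightarrow> rubinstein_share \<delta> * (1 - (\<delta> Firm * \<delta> Worker) ^ (T div 2))
                 / (1 - \<delta> Worker * (\<delta> Firm * \<delta> Worker) ^ (T div 2)))"

section \<open>Solving the recursion for the worker's share\<close>

context wage_bargaining
begin

lemma discount_product: "0 < \<delta> Firm * \<delta> Worker" "\<delta> Firm * \<delta> Worker < 1"
  using discount_pos[of Firm] discount_pos[of Worker] discount_less_1[of Firm] discount_less_1[of Worker]
    mult_strict_mono[of "\<delta> Firm" 1 "\<delta> Worker" 1] by simp_all

lemma rubinstein_share_bounds: "0 < rubinstein_share \<delta>" "rubinstein_share \<delta> < 1"
  using discount_product discount_pos[of Worker] discount_less_1[of Firm] discount_less_1[of Worker]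
  by (simp_all add: rubinstein_share_def right_diff_distrib mult.commute)

lemma rubinstein_share_eq:
  "rubinstein_share \<delta> * (1 - \<delta> Firm * \<delta> Worker) = \<delta> Worker * (1 - \<delta> Firm)"
  using discount_product by (simp add: rubinstein_share_def)

text \<open>Reduces the recursion for two sides to one sequence of shares of \<open>S\<close>; the
  worker responds in even periods, the firm in odd ones.\<close>

lemma equilibrium_values_worker_shares:
  assumes "0 \<le> S" and bounds: "\<And>t. 0 \<le> x t \<and> x t \<le> 1"
    and even: "\<And>t. even t \<Longrightarrow> x t = (let c = \<delta> Worker * x (Suc t)
      in if may_switch m T t then max c (x 0) else c)"
    and odd: "\<And>t. odd t \<Longrightarrow> 1 - x t = (let c = \<delta> Firm * (1 - x (Suc t))
      in if may_switch m T t then max c (1 - x 0) else c)"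
  shows "equilibrium_values (\<lambda>t. by_side (S * (1 - x t)) (S * x t))"
  unfolding equilibrium_values_def
proof (intro conjI allI)
  fix t s
  show "0 \<le> by_side (S * (1 - x t)) (S * x t) s"
    using assms(1) bounds by (cases s) auto
  show "by_side (S * (1 - x t)) (S * x t) Firm + by_side (S * (1 - x t)) (S * x t) Worker = S"
    by (simp add: algebra_simps)
  have scale: "S * (let c = a * b in if Q then max c d else c) =
      (let c = a * (S * b) in if Q then max c (S * d) else c)" for a b d Q
    using assms(1) by (simp add: Let_def max_mult_distrib_left mult.left_commute)
  show "by_side (S * (1 - x t)) (S * x t) (responder t) =
      (let c = \<delta> (responder t) * by_side (S * (1 - x (Suc t))) (S * x (Suc t)) (responder t)
       in if may_switch m T t then max c (by_side (S * (1 - x 0)) (S * x 0) m) else c)"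
  proof (cases "even t")
    case True
    then have r: "responder t = Worker"
      by (simp add: responder_def proposer_def)
    show ?thesis
    proof (cases "may_switch m T t")
      case sw: True
      then have "m = Worker"
        using r may_switch_responder by metis
      then show ?thesis
        using arg_cong[OF even[OF True], of "\<lambda>v. S * v"] r unfolding scale by (simp add: Let_def)
    next
      case False
      then show ?thesis
        using arg_cong[OF even[OF True], of "\<lambda>v. S * v"] r unfolding scale by (simp add: Let_def)
    qed
  next
    case False
    then have r: "responder t = Firm"
      by (simp add: responder_def proposer_def)
    show ?thesis
    proof (cases "may_switch m T t")
      case sw: True
      then have "m = Firm"
        using r may_switch_responder by metis
      then show ?thesis
        using arg_cong[OF odd[OF False], of "\<lambda>v. S * v"] r unfolding scale by (simp add: Let_def)
    next
      case sw: False
      then show ?thesis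
        using arg_cong[OF odd[OF False], of "\<lambda>v. S * v"] r unfolding scale by (simp add: Let_def)
    qed
  qed
qed

text \<open>The solution of period two does not depend on \<open>T\<close>: in an even period
  continuing and restarting are both worth \<open>rubinstein_share \<delta>\<close> to the worker,
  so the maximum is a tie.\<close>

lemma worker_switch_values:
  assumes "m = Worker" "0 \<le> S"
  shows "\<exists>V. equilibrium_values V \<and> V 0 Worker = S * rubinstein_share \<delta>"
proof -
  let ?a = "rubinstein_share \<delta>"
  define x where "x t = (if even t then ?a else 1 - \<delta> Firm * (1 - ?a))" for t :: nat
  have fixpoint: "\<delta> Worker * (1 - \<delta> Firm * (1 - ?a)) = ?a"
    using rubinstein_share_eq by (simp add: algebra_simps)
  have odd_share: "0 \<le> \<delta> Firm * (1 - ?a)" "\<delta> Firm * (1 - ?a) \<le> 1"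
    using rubinstein_share_bounds discount_pos[of Firm] discount_less_1[of Firm]
    by (auto intro!: mult_le_one)
  have "equilibrium_values (\<lambda>t. by_side (S * (1 - x t)) (S * x t))"
  proof (rule equilibrium_values_worker_shares[OF assms(2)])
    show "0 \<le> x t \<and> x t \<le> 1" for t
      using rubinstein_share_bounds odd_share by (simp add: x_def)
    show "x t = (let c = \<delta> Worker * x (Suc t) in if may_switch m T t then max c (x 0) else c)"
      if "even t" for t
      using that by (simp add: x_def Let_def fixpoint)
    show "1 - x t = (let c = \<delta> Firm * (1 - x (Suc t)) in if may_switch m T t then max c (1 - x 0) else c)"
      if "odd t" for t
      using that assms(1) by (simp add: x_def Let_def may_switch_def responder_def proposer_def)
  qed
  moreover have "by_side (S * (1 - x 0)) (S * x 0) Worker = S * ?a"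
    by (simp add: x_def)
  ultimately show ?thesis by blast
qed

text \<open>From \<open>T\<close> on the firm switches in every odd period, which leaves the worker
  the share that the firm would concede at period 0 of a new match. That share \<open>\<nu>\<close>
  is thus propagated back through \<open>k\<close> rounds to period 0 and must reproduce itself; the
  formula in \<open>initial_worker_share\<close> is the solution of this linear equation.\<close>

lemma firm_switch_values:
  assumes m: "m = Firm" and "0 \<le> S" and T: "T = Suc (2 * k)"
  shows "\<exists>V. equilibrium_values V \<and> V 0 Worker = S * initial_worker_share m T \<delta>"
proof -
  let ?a = "rubinstein_share \<delta>" and ?P = "\<delta> Firm * \<delta> Worker"
  define \<nu> where "\<nu> = initial_worker_share m T \<delta>"
  \<comment> \<open>The worker's share \<open>j\<close> rounds before period
    \<open>T - 1 = 2 * k\<close>: it starts at \<open>\<delta> Worker * \<nu>\<close>, and each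
    round is an affine map with slope \<open>?P\<close> and fixed point \<open>?a\<close>.\<close>
  define x\<^sub>e where "x\<^sub>e j = ?a + ?P ^ j * (\<delta> Worker * \<nu> - ?a)" for j
  \<comment> \<open>Truncated subtraction makes \<open>k - t div 2\<close> equal to 0 for all later
    even periods, so the shares are stationary there.\<close>
  define x where "x t = (if even t then x\<^sub>e (k - t div 2)
      else if T \<le> t then \<nu> else 1 - \<delta> Firm * (1 - x\<^sub>e (k - Suc t div 2)))" for t
  have Pk: "0 \<le> ?P ^ j" "?P ^ j \<le> 1" for j
    using discount_product by (auto intro: power_le_one)
  have den: "\<delta> Worker * ?P ^ k < 1"
  proof -
    have "\<delta> Worker * ?P ^ k \<le> \<delta> Worker"
      by (rule mult_left_le[OF Pk(2)]) (simp add: discount_pos less_imp_le)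
    then show ?thesis
      using discount_less_1[of Worker] by linarith
  qed
  have \<nu>: "\<nu> = ?a * (1 - ?P ^ k) / (1 - \<delta> Worker * ?P ^ k)"
    by (simp add: \<nu>_def initial_worker_share_def m T)
  have restart: "x\<^sub>e k = \<nu>"
  proof -
    have "\<nu> * (1 - \<delta> Worker * ?P ^ k) = ?a * (1 - ?P ^ k)"
      using den by (simp add: \<nu>)
    then show ?thesis
      by (simp add: x\<^sub>e_def algebra_simps)
  qed
  have "0 \<le> \<nu>"
    unfolding \<nu> using rubinstein_share_bounds den Pk(2)[of k] by (intro divide_nonneg_pos mult_nonneg_nonneg) auto
  have "\<nu> \<le> ?a"
  proof -
    have "?a * (1 - ?P ^ k) \<le> ?a * (1 - \<delta> Worker * ?P ^ k)"
      using rubinstein_share_bounds Pk(1)[of k] discount_less_1[of Worker] discount_pos[of Worker]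
      by (intro mult_left_mono) (auto simp: mult_left_le_one_le less_imp_le)
    then show ?thesis
      unfolding \<nu> using den by (simp add: pos_divide_le_eq)
  qed
  have x\<^sub>e_bounds: "0 \<le> x\<^sub>e j \<and> x\<^sub>e j \<le> 1" for j
  proof -
    have "x\<^sub>e j = (1 - ?P ^ j) * ?a + ?P ^ j * (\<delta> Worker * \<nu>)"
      by (simp add: x\<^sub>e_def algebra_simps)
    moreover have "0 \<le> \<delta> Worker * \<nu>" "\<delta> Worker * \<nu> \<le> 1"
      using \<open>0 \<le> \<nu>\<close> \<open>\<nu> \<le> ?a\<close> rubinstein_share_bounds discount_pos[of Worker] discount_less_1[of Worker]
      by (auto intro!: mult_le_one)
    ultimately show ?thesis
      using Pk[of j] rubinstein_share_bounds convex_bound_le[of ?a 1 "\<delta> Worker * \<nu>" "1 - ?P ^ j" "?P ^ j"]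
      by simp
  qed
  have step: "x\<^sub>e (Suc j) = \<delta> Worker * (1 - \<delta> Firm * (1 - x\<^sub>e j))" for j
  proof -
    have "\<delta> Worker * (1 - \<delta> Firm * (1 - ?a)) = ?a"
      using rubinstein_share_eq by (simp add: algebra_simps)
    then show ?thesis
      by (simp add: x\<^sub>e_def algebra_simps)
  qed
  \<comment> \<open>Switching is optimal for the firm from \<open>T\<close> on. As
    \<open>x\<^sub>e 0\<close> is \<open>\<delta> Worker * \<nu>\<close>, the claim amounts to
    \<open>\<nu> * (1 - ?P) \<le> 1 - \<delta> Firm\<close>.\<close>
  have "\<delta> Firm * (1 - x\<^sub>e 0) \<le> 1 - \<nu>"
  proof -
    have "\<nu> * (1 - ?P) \<le> ?a * (1 - ?P)"
      using \<open>\<nu> \<le> ?a\<close> discount_product by (intro mult_right_mono) auto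
    also have "\<dots> \<le> 1 - \<delta> Firm"
      using rubinstein_share_eq discount_less_1[of Firm] discount_less_1[of Worker] discount_pos[of Worker]
      by (simp add: mult_left_le_one_le less_imp_le)
    finally show ?thesis
      by (simp add: x\<^sub>e_def algebra_simps)
  qed
  note stay = this
  have "equilibrium_values (\<lambda>t. by_side (S * (1 - x t)) (S * x t))"
  proof (rule equilibrium_values_worker_shares[OF assms(2)])
    show "0 \<le> x t \<and> x t \<le> 1" for t
    proof -
      have "0 \<le> \<delta> Firm * (1 - x\<^sub>e j)" "\<delta> Firm * (1 - x\<^sub>e j) \<le> 1" for j
        using x\<^sub>e_bounds[of j] discount_pos[of Firm] discount_less_1[of Firm]
        by (auto intro!: mult_le_one)
      then show ?thesis
        using x\<^sub>e_bounds \<open>0 \<le> \<nu>\<close> \<open>\<nu> \<le> ?a\<close> rubinstein_share_bounds by (simp add: x_def)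
    qed
    show "x t = (let c = \<delta> Worker * x (Suc t) in if may_switch m T t then max c (x 0) else c)"
      if "even t" for t
    proof -
      obtain i where i: "t = 2 * i"
        using \<open>even t\<close> by (elim evenE)
      have "x t = \<delta> Worker * x (Suc t)"
      proof (cases "i < k")
        case True
        then have "k - i = Suc (k - Suc i)"
          by simp
        with True show ?thesis
          by (simp add: x_def i T step)
      next
        case False
        then show ?thesis
          by (simp add: x_def i T x\<^sub>e_def)
      qed
      then show ?thesis
        using \<open>even t\<close> m by (simp add: may_switch_def responder_def proposer_def)
    qed
    show "1 - x t = (let c = \<delta> Firm * (1 - x (Suc t)) in if may_switch m T t then max c (1 - x 0) else c)"
      if "odd t" for t
    proof -
      obtain i where i: "t = Suc (2 * i)"
        using \<open>odd t\<close> by (elim oddE) simp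
      have "may_switch m T t \<longleftrightarrow> k \<le> i"
        by (simp add: may_switch_def responder_def proposer_def m T i)
      moreover have "x 0 = \<nu>"
        by (simp add: x_def restart)
      ultimately show ?thesis
        using stay by (auto simp: x_def i T Let_def)
    qed
  qed
  moreover have "by_side (S * (1 - x 0)) (S * x 0) Worker = S * \<nu>"
    by (simp add: x_def restart)
  ultimately show ?thesis
    unfolding \<nu>_def by blast
qed

text \<open>With \<open>T = 1\<close> the firm could switch at its first response,
  \<open>T div 2\<close> would be 0 and the worker's share would vanish. Strict bounds are what
  \<open>agreed_wage_unique\<close> asks for.\<close>

lemma initial_worker_share_bounds:
  assumes "m = Firm \<Longrightarrow> 1 < T"
  shows "0 < initial_worker_share m T \<delta>" "initial_worker_share m T \<delta> < 1"
proof -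
  have "0 < initial_worker_share m T \<delta> \<and> initial_worker_share m T \<delta> < 1"
  proof (cases m)
    case Worker
    then show ?thesis
      using rubinstein_share_bounds by (simp add: initial_worker_share_def)
  next
    case Firm
    let ?p = "(\<delta> Firm * \<delta> Worker) ^ (T div 2)"
    have "0 < T div 2"
      using assms Firm by simp
    then have p: "0 < ?p" "?p < 1"
      using discount_product by (simp_all add: power_less_one_iff)
    have "\<delta> Worker * ?p < 1 * ?p"
      using p discount_less_1 by (intro mult_strict_right_mono) auto
    then have "0 < 1 - \<delta> Worker * ?p" "1 - ?p < 1 - \<delta> Worker * ?p" "0 < 1 - ?p"
      using p by linarith+
    then have "0 < (1 - ?p) / (1 - \<delta> Worker * ?p)" "(1 - ?p) / (1 - \<delta> Worker * ?p) < 1"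
      by (simp_all only: divide_pos_pos divide_less_eq_1_pos)
    moreover have "0 < a * c \<and> a * c < 1 * 1" if "0 < a" "a < 1" "0 < c" "c < 1" for a c :: real
      using that by (intro conjI mult_pos_pos mult_strict_mono) auto
    ultimately have "0 < rubinstein_share \<delta> * ((1 - ?p) / (1 - \<delta> Worker * ?p))"
      "rubinstein_share \<delta> * ((1 - ?p) / (1 - \<delta> Worker * ?p)) < 1 * 1"
      using rubinstein_share_bounds by blast+
    then show ?thesis
      using Firm by (simp add: initial_worker_share_def)
  qed
  then show "0 < initial_worker_share m T \<delta>" "initial_worker_share m T \<delta> < 1"
    by simp_all
qed

text \<open>Existence and uniqueness as one equivalence, so that it can be rewritten under the
  quantifier over \<open>\<phi>\<^sub>U\<close>, on which both \<open>S\<close> and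
  \<open>gain\<close> depend.\<close>

theorem agreed_wage_iff:
  assumes T: "0 < T" "m = Firm \<Longrightarrow> odd T \<and> 1 < T"
  shows "(\<exists>\<sigma>. subgame_perfect G \<sigma> \<and> agreed_wage m T \<delta> gain \<sigma> w) \<longleftrightarrow>
    0 \<le> S \<and> gain Worker w = S * initial_worker_share m T \<delta>"
proof -
  have solvable: "\<exists>V. equilibrium_values V \<and> V 0 Worker = S * initial_worker_share m T \<delta>" if "0 \<le> S"
  proof (cases m)
    case Worker
    then show ?thesis
      using worker_switch_values[OF Worker that] by (simp add: initial_worker_share_def)
  next
    case Firm
    then obtain k where "T = Suc (2 * k)"
      using T(2) by (auto elim: oddE)
    then show ?thesis
      using firm_switch_values[OF Firm that] by blast
  qed
  show ?thesis
  proof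
    assume "\<exists>\<sigma>. subgame_perfect G \<sigma> \<and> agreed_wage m T \<delta> gain \<sigma> w"
    then obtain \<sigma> where \<sigma>: "subgame_perfect G \<sigma>" "agreed_wage m T \<delta> gain \<sigma> w"
      by blast
    interpret bargaining_equilibrium m T \<delta> gain S \<sigma>
      by unfold_locales (fact \<sigma>(1))
    have S: "0 \<le> S"
      by (rule agreed_surplus_nonneg[OF \<sigma>(2)])
    obtain V where V: "equilibrium_values V" "V 0 Worker = S * initial_worker_share m T \<delta>"
      using solvable[OF S] by blast
    have "\<not> may_switch m T 0"
      using T(1) by (simp add: may_switch_def)
    moreover have "0 < V 0 Worker \<and> V 0 Worker < S" if "0 < S"
      using that initial_worker_share_bounds T(2) V(2) by simp
    ultimately show "0 \<le> S \<and> gain Worker w = S * initial_worker_share m T \<delta>"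
      using agreed_wage_unique[OF V(1) _ _ \<sigma>(2)] S V(2) by simp
  next
    assume *: "0 \<le> S \<and> gain Worker w = S * initial_worker_share m T \<delta>"
    then obtain V where "equilibrium_values V" "V 0 Worker = S * initial_worker_share m T \<delta>"
      using solvable by blast
    then show "\<exists>\<sigma>. subgame_perfect G \<sigma> \<and> agreed_wage m T \<delta> gain \<sigma> w"
      using * equilibrium_move_subgame_perfect equilibrium_agreed_wage by metis
  qed
qed

end

section \<open>Closing the value of unemployment\<close>

text \<open>Here \<open>v\<close> is the flow value of unemployment, \<open>x\<close> the worker's
  share and \<open>c\<close> the effective rate \<open>r + lam\<close>; \<open>v \<le> y\<close>
  says that the surplus is nonnegative.\<close>

lemma wage_fixpoint:
  fixes b c f w x y :: real
  assumes "0 < c" "0 < x" "0 < f" "b \<le> y"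
  shows "(\<exists>v. v = b + f * ((w - v) / c) \<and> v \<le> y \<and> w = v + (y - v) * x) \<longleftrightarrow>
    w = b + x * (c + f) / (c + x * f) * (y - b)"
proof -
  have d: "0 < c + x * f"
    using assms by (simp add: add_pos_pos)
  \<comment> \<open>In these units the worker's net gain \<open>(w - v) / c\<close> is
    \<open>x * e\<close> and the total surplus \<open>(y - v) / c\<close> is
    \<open>e\<close>.\<close>
  define e where "e = (y - b) / (c + x * f)"
  have y: "y = b + e * (c + x * f)"
    using d by (simp add: e_def)
  have "0 \<le> e"
    using d assms(4) by (simp add: e_def)
  have wage: "b + x * (c + f) / (c + x * f) * (y - b) = b + x * (c + f) * e"
    by (simp add: e_def)
  show ?thesis
    unfolding wage
  proof
    assume "\<exists>v. v = b + f * ((w - v) / c) \<and> v \<le> y \<and> w = v + (y - v) * x"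
    then obtain v where v: "v = b + f * ((w - v) / c)" "w = v + (y - v) * x"
      by blast
    define t where "t = (w - v) / c"
    have t: "v = b + f * t" "w = v + c * t"
      using v(1) assms(1) by (simp_all add: t_def)
    then have "c * t = (e * (c + x * f) - f * t) * x"
      using v(2) y by simp
    then have "(c + x * f) * t = (c + x * f) * (e * x)"
      by (simp add: algebra_simps)
    then have "t = e * x"
      using d by simp
    then show "w = b + x * (c + f) * e"
      using t by (simp add: algebra_simps)
  next
    assume w: "w = b + x * (c + f) * e"
    have "(w - (b + f * x * e)) / c = x * e"
      using assms(1) by (simp add: w field_simps)
    moreover have "0 \<le> e * c"
      using \<open>0 \<le> e\<close> assms(1) by simp
    ultimately show "\<exists>v. v = b + f * ((w - v) / c) \<and> v \<le> y \<and> w = v + (y - v) * x"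
      by (intro exI[of _ "b + f * x * e"]) (simp add: w y algebra_simps)
  qed
qed

text \<open>For given \<open>\<phi>\<^sub>U\<close> the Bellman equations determine the other two
  value functions, so the only unknown left is \<open>\<phi>\<^sub>U\<close>; since \<open>r\<close>
  is positive, it can be traded for the flow value \<open>r * \<phi>\<^sub>U\<close>.\<close>

lemma equilibrium_wage_iff:
  fixes r lam \<rho> \<gamma> \<Delta> f y b :: real
  defines "\<delta> \<equiv> by_side (discount \<rho> lam (\<gamma> * \<Delta>)) (discount \<rho> lam \<Delta>)"
  assumes "0 < r" "0 < lam" "0 < f" "b \<le> y"
    and \<delta>: "\<And>s. 0 < \<delta> s \<and> \<delta> s < 1"
    and T: "0 < T" "m = Firm \<Longrightarrow> odd T \<and> 1 < T"
  shows "equilibrium_wage m T r \<rho> lam \<gamma> f y b \<Delta> w \<longleftrightarrow>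
    w = b + Psi r lam f (initial_worker_share m T \<delta>) * (y - b)"
proof -
  let ?c = "r + lam"
  define x where "x = initial_worker_share m T \<delta>"
  define gain where "gain u = by_side (\<lambda>v. (y - v) / ?c) (\<lambda>v. (v - r * u) / ?c)" for u
  have c: "0 < ?c" using assms by simp
  have bargaining: "wage_bargaining \<delta> (gain u) ((y - r * u) / ?c)" for u
  proof
    show "0 < \<delta> s" "\<delta> s < 1" for s
      using \<delta> by simp_all
    show "gain u Firm v + gain u Worker v = (y - r * u) / ?c" for v
      by (simp add: gain_def add_divide_distrib[symmetric])
    have "bij (\<lambda>v. (v - r * u) / ?c)"
      by (rule bij_betw_byWitness[where f' = "\<lambda>v. ?c * v + r * u"]) (use c in auto)
    then show "bij (gain u Worker)"
      by (simp add: gain_def)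
  qed
  have agreed: "(\<exists>\<sigma>. subgame_perfect (bargaining_game m T \<delta> (gain u)) \<sigma> \<and> agreed_wage m T \<delta> (gain u) \<sigma> w) \<longleftrightarrow>
      0 \<le> (y - r * u) / ?c \<and> gain u Worker w = (y - r * u) / ?c * x" for u
    unfolding x_def by (rule wage_bargaining.agreed_wage_iff[OF bargaining T(1)]) (use T(2) in blast)
  have x: "0 < x" "x < 1"
    using wage_bargaining.initial_worker_share_bounds[OF bargaining] T(2) by (auto simp: x_def)
  have "r * p = v + lam * (u - p) \<longleftrightarrow> p * ?c = v + lam * u" for p u v
    by (auto simp: algebra_simps)
  then have employed: "(\<forall>v. r * \<phi> v = v + lam * (u - \<phi> v)) \<longleftrightarrow> \<phi> = (\<lambda>v. (v + lam * u) / ?c)" for \<phi> u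
    using c by (simp add: fun_eq_iff eq_divide_eq)
  have "r * p = y - v - lam * p \<longleftrightarrow> p * ?c = y - v" for p v
    by (auto simp: algebra_simps)
  then have filled: "(\<forall>v. r * \<pi> v = y - v - lam * \<pi> v) \<longleftrightarrow> \<pi> = (\<lambda>v. (y - v) / ?c)" for \<pi>
    using c by (simp add: fun_eq_iff eq_divide_eq)
  have rescale: "(\<exists>u. Q (r * u)) \<longleftrightarrow> (\<exists>v. Q v)" for Q
  proof
    assume "\<exists>v. Q v"
    then obtain v where "Q v" ..
    then have "Q (r * (v / r))"
      using assms(2) by simp
    then show "\<exists>u. Q (r * u)" ..
  qed blast
  have net: "(v + lam * u) / ?c - u = (v - r * u) / ?c" for u v
    using c by (simp add: field_simps)
  have "equilibrium_wage m T r \<rho> lam \<gamma> f y b \<Delta> w \<longleftrightarrow>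
      (\<exists>u. r * u = b + f * ((w + lam * u) / ?c - u) \<and>
        (\<exists>\<sigma>. subgame_perfect (bargaining_game m T \<delta> (gain u)) \<sigma> \<and> agreed_wage m T \<delta> (gain u) \<sigma> w))"
    unfolding equilibrium_wage_def employed filled \<delta>_def[symmetric]
    by (auto simp: gain_def net)
  also have "\<dots> \<longleftrightarrow> (\<exists>u. r * u = b + f * ((w - r * u) / ?c) \<and> 0 \<le> (y - r * u) / ?c \<and>
      (w - r * u) / ?c = (y - r * u) / ?c * x)"
    unfolding agreed net by (simp add: gain_def)
  also have "\<dots> \<longleftrightarrow> (\<exists>u. r * u = b + f * ((w - r * u) / ?c) \<and> r * u \<le> y \<and> w = r * u + (y - r * u) * x)"
  proof (intro ex_cong1 conj_cong refl)
    fix u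
    show "0 \<le> (y - r * u) / ?c \<longleftrightarrow> r * u \<le> y"
      using c by (simp add: zero_le_divide_iff)
    have "(w - r * u) / ?c = (y - r * u) / ?c * x \<longleftrightarrow> w - r * u = (y - r * u) * x"
      using c by simp
    then show "(w - r * u) / ?c = (y - r * u) / ?c * x \<longleftrightarrow> w = r * u + (y - r * u) * x"
      by linarith
  qed
  also have "\<dots> \<longleftrightarrow> (\<exists>v. v = b + f * ((w - v) / ?c) \<and> v \<le> y \<and> w = v + (y - v) * x)"
    by (rule rescale[of "\<lambda>v. v = b + f * ((w - v) / ?c) \<and> v \<le> y \<and> w = v + (y - v) * x"])
  also have "\<dots> \<longleftrightarrow> w = b + Psi r lam f x * (y - b)"
    unfolding Psi_def using c x(1) assms(4,5) by (intro wage_fixpoint)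
  finally show ?thesis
    by (simp add: x_def)
qed


section \<open>Vanishing response times\<close>

lemma limit_wageI:
  assumes "\<forall>\<^sub>F \<Delta> in at_right 0. \<forall>w. E \<Delta> w \<longleftrightarrow> w = W \<Delta>" and "(W \<longlongrightarrow> L) (at_right 0)"
  shows "limit_wage E L"
  unfolding limit_wage_def
proof
  show "\<forall>\<^sub>F \<Delta> in at_right 0. \<exists>!w. E \<Delta> w"
    using assms(1) by (rule eventually_mono) simp
  have "\<forall>\<^sub>F \<Delta> in at_right 0. W \<Delta> = (THE w. E \<Delta> w)"
    using assms(1) by (rule eventually_mono) simp
  then show "((\<lambda>\<Delta>. THE w. E \<Delta> w) \<longlongrightarrow> L) (at_right 0)"
    using assms(2) by (rule Lim_transform_eventually[rotated])
qed

text \<open>Dividing numerator and denominator by \<open>x\<close> gives two difference quotients at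
  0.\<close>

lemma tendsto_one_minus_quotient:
  fixes u v :: "real \<Rightarrow> real"
  assumes "(u has_real_derivative u') (at 0)" "u 0 = 1"
    and "(v has_real_derivative v') (at 0)" "v 0 = 1" "v' \<noteq> 0"
  shows "((\<lambda>x. (1 - u x) / (1 - v x)) \<longlongrightarrow> u' / v') (at_right 0)"
proof -
  have "((\<lambda>x. (u x - 1) / x) \<longlongrightarrow> u') (at_right 0)" "((\<lambda>x. (v x - 1) / x) \<longlongrightarrow> v') (at_right 0)"
    using assms unfolding has_field_derivative_iff by (auto intro: tendsto_mono[OF at_le])
  then have "((\<lambda>x. ((u x - 1) / x) / ((v x - 1) / x)) \<longlongrightarrow> u' / v') (at_right 0)"
    using assms(5) by (rule tendsto_divide)
  moreover have "\<forall>\<^sub>F x in at_right 0. ((u x - 1) / x) / ((v x - 1) / x) = (1 - u x) / (1 - v x)"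
    using eventually_at_right_less
  proof eventually_elim
    case (elim x)
    have "(u x - 1) / (v x - 1) = (1 - u x) / (1 - v x)"
      using minus_divide_divide[of "1 - u x" "1 - v x"] by simp
    with elim show ?case by simp
  qed
  ultimately show ?thesis
    by (rule Lim_transform_eventually)
qed

lemma discount_bounds:
  assumes "0 \<le> \<rho>" "0 < lam" "0 < \<tau>" "\<tau> < 1 / lam"
  shows "0 < discount \<rho> lam \<tau>" "discount \<rho> lam \<tau> < 1"
proof -
  have "0 < 1 - \<tau> * lam" "1 - \<tau> * lam < 1"
    using assms by (simp_all add: field_simps)
  moreover have "(1 - \<tau> * lam) * exp (- \<rho> * \<tau>) \<le> 1 - \<tau> * lam"
    using assms calculation by (intro mult_left_le) simp_all
  ultimately show "0 < discount \<rho> lam \<tau>" "discount \<rho> lam \<tau> < 1"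
    unfolding discount_def by (simp, linarith)
qed

lemma discount_derivative:
  "((\<lambda>\<Delta>. discount \<rho> lam (c * \<Delta>)) has_real_derivative - c * (\<rho> + lam)) (at 0)"
  unfolding discount_def by (auto intro!: derivative_eq_intros simp: algebra_simps)

text \<open>The share is a product of quotients \<open>(1 - u) / (1 - v)\<close> and a factor
  tending to 1. All derivatives at 0 are multiples of \<open>\<rho> + lam\<close>, which cancels, so
  only \<open>\<gamma>\<close> and \<open>k\<close> survive.\<close>

lemma initial_worker_share_limit:
  fixes \<gamma> \<rho> lam :: real and T :: nat
  assumes "0 < \<gamma>" "0 < \<rho> + lam"
  defines "\<delta> \<equiv> \<lambda>\<Delta>. by_side (discount \<rho> lam (\<gamma> * \<Delta>)) (discount \<rho> lam \<Delta>)"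
    and "k \<equiv> real (T div 2)"
  shows "((\<lambda>\<Delta>. initial_worker_share m T (\<delta> \<Delta>)) \<longlongrightarrow>
    (case m of Worker \<Rightarrow> \<gamma> / (1 + \<gamma>) | Firm \<Rightarrow> \<gamma> * k / (1 + k * (1 + \<gamma>)))) (at_right 0)"
proof -
  let ?e = "\<rho> + lam"
  have W: "((\<lambda>\<Delta>. \<delta> \<Delta> Worker) has_real_derivative - ?e) (at 0)"
    using discount_derivative[of \<rho> lam 1] by (simp add: \<delta>_def)
  have F: "((\<lambda>\<Delta>. \<delta> \<Delta> Firm) has_real_derivative - \<gamma> * ?e) (at 0)"
    using discount_derivative[of \<rho> lam \<gamma>] by (simp add: \<delta>_def)
  have 0: "\<delta> 0 Worker = 1" "\<delta> 0 Firm = 1"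
    by (simp_all add: \<delta>_def discount_def)
  have P: "((\<lambda>\<Delta>. \<delta> \<Delta> Firm * \<delta> \<Delta> Worker) has_real_derivative - (1 + \<gamma>) * ?e) (at 0)"
    by (rule DERIV_cong[OF DERIV_mult[OF F W]]) (simp add: 0 algebra_simps)
  have Pk: "((\<lambda>\<Delta>. (\<delta> \<Delta> Firm * \<delta> \<Delta> Worker) ^ (T div 2)) has_real_derivative - k * (1 + \<gamma>) * ?e) (at 0)"
    by (rule DERIV_cong[OF DERIV_power[OF P]]) (simp add: 0 k_def algebra_simps)
  have WPk: "((\<lambda>\<Delta>. \<delta> \<Delta> Worker * (\<delta> \<Delta> Firm * \<delta> \<Delta> Worker) ^ (T div 2)) has_real_derivative
      - (1 + k * (1 + \<gamma>)) * ?e) (at 0)"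
    by (rule DERIV_cong[OF DERIV_mult[OF W Pk]]) (simp add: 0 algebra_simps)
  have W1: "((\<lambda>\<Delta>. \<delta> \<Delta> Worker) \<longlongrightarrow> 1) (at_right 0)"
    using DERIV_isCont[OF W] 0 unfolding isCont_def by (auto intro: tendsto_mono[OF at_le])
  have R: "((\<lambda>\<Delta>. rubinstein_share (\<delta> \<Delta>)) \<longlongrightarrow> \<gamma> / (1 + \<gamma>)) (at_right 0)"
  proof -
    have "((\<lambda>\<Delta>. \<delta> \<Delta> Worker * ((1 - \<delta> \<Delta> Firm) / (1 - \<delta> \<Delta> Firm * \<delta> \<Delta> Worker))) \<longlongrightarrow>
        1 * ((- \<gamma> * ?e) / (- (1 + \<gamma>) * ?e))) (at_right 0)"
      using assms(1,2) by (intro tendsto_mult W1 tendsto_one_minus_quotient[OF F _ P]) (simp_all add: 0)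
    also have "(- \<gamma> * ?e) / (- (1 + \<gamma>) * ?e) = \<gamma> / (1 + \<gamma>)"
      using assms(2) by (simp only: minus_mult_left[symmetric] minus_divide_divide
          mult_divide_mult_cancel_right[OF less_imp_neq[symmetric]])
    finally show ?thesis
      by (simp add: rubinstein_share_def)
  qed
  have k: "0 \<le> k" "0 < 1 + k * (1 + \<gamma>)"
    using assms(1) by (auto simp: k_def intro!: add_pos_nonneg)
  show ?thesis
  proof (cases m)
    case Worker
    then show ?thesis
      using R by (simp add: initial_worker_share_def)
  next
    case Firm
    have "((\<lambda>\<Delta>. rubinstein_share (\<delta> \<Delta>) * ((1 - (\<delta> \<Delta> Firm * \<delta> \<Delta> Worker) ^ (T div 2)) /
        (1 - \<delta> \<Delta> Worker * (\<delta> \<Delta> Firm * \<delta> \<Delta> Worker) ^ (T div 2))))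
      \<longlongrightarrow> \<gamma> / (1 + \<gamma>) * ((- k * (1 + \<gamma>) * ?e) / (- (1 + k * (1 + \<gamma>)) * ?e))) (at_right 0)"
      using k assms(2) by (intro tendsto_mult R tendsto_one_minus_quotient[OF Pk _ WPk]) (simp_all add: 0)
    also have "(- k * (1 + \<gamma>) * ?e) / (- (1 + k * (1 + \<gamma>)) * ?e) = (k * (1 + \<gamma>)) / (1 + k * (1 + \<gamma>))"
      using assms(2) by (simp only: minus_mult_left[symmetric] minus_divide_divide
          mult_divide_mult_cancel_right[OF less_imp_neq[symmetric]])
    also have "\<gamma> / (1 + \<gamma>) * (k * (1 + \<gamma>) / (1 + k * (1 + \<gamma>))) = \<gamma> * k / (1 + k * (1 + \<gamma>))"
      using assms(1) by simp
    finally show ?thesis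
      using Firm by (simp add: initial_worker_share_def)
  qed
qed

lemma equilibrium_wage_limit:
  fixes r lam \<rho> \<gamma> f y b :: real
  assumes "0 < r" "0 < lam" "0 \<le> \<rho>" "0 < f" "b \<le> y" "0 < \<gamma>"
    and T: "0 < T" "m = Firm \<Longrightarrow> odd T \<and> 1 < T"
    and \<Gamma>: "\<Gamma> = (case m of Worker \<Rightarrow> \<gamma> / (1 + \<gamma>)
      | Firm \<Rightarrow> \<gamma> * real (T div 2) / (1 + real (T div 2) * (1 + \<gamma>)))"
  shows "limit_wage (equilibrium_wage m T r \<rho> lam \<gamma> f y b) (b + Psi r lam f \<Gamma> * (y - b))"
proof (rule limit_wageI)
  let ?\<delta> = "\<lambda>\<Delta>. by_side (discount \<rho> lam (\<gamma> * \<Delta>)) (discount \<rho> lam \<Delta>)"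
  have "\<forall>\<^sub>F \<Delta> in at_right 0. \<Delta> < min (1 / lam) (1 / (lam * \<gamma>))"
    using assms by (intro eventually_at_rightI[of 0 "min (1 / lam) (1 / (lam * \<gamma>))"]) auto
  then show "\<forall>\<^sub>F \<Delta> in at_right 0. \<forall>w. equilibrium_wage m T r \<rho> lam \<gamma> f y b \<Delta> w \<longleftrightarrow>
      w = b + Psi r lam f (initial_worker_share m T (?\<delta> \<Delta>)) * (y - b)"
    using eventually_at_right_less
  proof eventually_elim
    case (elim \<Delta>)
    have "0 < ?\<delta> \<Delta> s \<and> ?\<delta> \<Delta> s < 1" for s
      using elim assms(2,3,6) discount_bounds[of \<rho> lam \<Delta>] discount_bounds[of \<rho> lam "\<gamma> * \<Delta>"]
      by (cases s) (auto simp: field_simps)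
    then show ?case
      using equilibrium_wage_iff[OF assms(1,2,4,5) _ T] by simp
  qed
  have "0 \<le> \<Gamma>"
    using assms(6) by (cases m) (auto simp: \<Gamma>)
  then have "r + lam + \<Gamma> * f \<noteq> 0"
    using assms(1,2,4) by (smt (verit) mult_nonneg_nonneg)
  moreover have "((\<lambda>\<Delta>. initial_worker_share m T (?\<delta> \<Delta>)) \<longlongrightarrow> \<Gamma>) (at_right 0)"
    using assms(2,3) unfolding \<Gamma> by (intro initial_worker_share_limit assms) simp
  ultimately show "((\<lambda>\<Delta>. b + Psi r lam f (initial_worker_share m T (?\<delta> \<Delta>)) * (y - b))
      \<longlongrightarrow> b + Psi r lam f \<Gamma> * (y - b)) (at_right 0)"
    unfolding Psi_def by (intro tendsto_intros)
qed

theorem proposition1: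
  fixes q :: "real \<Rightarrow> real" and \<theta> lam \<rho> g \<alpha> mdot y b \<gamma> Tw r f \<Psi>a \<Psi>b :: real
    and M :: "'a measure" and TF TW :: "'a \<Rightarrow> real" and nF nW :: nat
  assumes "\<theta> > 0" and "0 < q \<theta>" and "q \<theta> < 1" and "f = \<theta> * q \<theta>"
    and "lam > 0" and "\<rho> \<ge> 0" and "\<alpha> > 0"
    and "r = \<rho> + \<alpha> * mdot - g" and "r > 0"
    and "b \<le> y"
    and "\<gamma> > 0" and "Tw > 0"
    and "prob_space M"
    and "distributed M lborel TF (exponential_density (q \<theta>))"
    and "distributed M lborel TW (exponential_density (f / Tw))"
    and "prob_space.indep_var M borel TF borel TW"
    and "\<Psi>a = Psi r lam f (Gamma_na \<gamma>)"
    and "\<Psi>b = Psi r lam f (Gamma_nb \<gamma> (q \<theta>))"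
  shows
    "(even nW \<and> real nW = Tw / f \<longrightarrow>
        limit_wage (equilibrium_wage Worker nW r \<rho> lam \<gamma> f y b) (b + \<Psi>a * (y - b)))
   \<and> (odd nF \<and> real nF = 1 / q \<theta> \<longrightarrow>
        limit_wage (equilibrium_wage Firm nF r \<rho> lam \<gamma> f y b) (b + \<Psi>b * (y - b)))
   \<and> (even nW \<and> real nW = Tw / f \<and> odd nF \<and> real nF = 1 / q \<theta> \<longrightarrow>
        (\<exists>wa wb.
           limit_wage (equilibrium_wage Worker nW r \<rho> lam \<gamma> f y b) wa \<and>
           limit_wage (equilibrium_wage Firm nF r \<rho> lam \<gamma> f y b) wb \<and>
           average_wage M TF TW wb wa =
             b + (Tw * \<Psi>b + \<theta> * \<Psi>a) / (Tw + \<theta>) * (y - b)))"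
proof -
  have f: "0 < f"
    using assms(1,2,4) by simp
  have na: "limit_wage (equilibrium_wage Worker nW r \<rho> lam \<gamma> f y b) (b + \<Psi>a * (y - b))"
    if "real nW = Tw / f"
  proof -
    have "0 < real nW"
      using that f \<open>Tw > 0\<close> by simp
    then show ?thesis
      unfolding \<open>\<Psi>a = _\<close> using assms f
      by (intro equilibrium_wage_limit) (simp_all add: Gamma_na_def)
  qed
  have nb: "limit_wage (equilibrium_wage Firm nF r \<rho> lam \<gamma> f y b) (b + \<Psi>b * (y - b))"
    if nF: "odd nF" "real nF = 1 / q \<theta>"
  proof -
    \<comment> \<open>This is where \<open>q \<theta> < 1\<close> enters: it excludes the degenerate
      case of a switch at period 1.\<close>
    have "1 < real nF"
      using nF(2) assms(2,3) by simp
    obtain k where k: "nF = Suc (2 * k)"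
      using nF(1) by (elim oddE) simp
    then have q: "q \<theta> = 1 / (1 + 2 * real k)"
      using nF(2) assms(2) by (simp add: field_simps)
    have "0 < 1 + real k * (1 + \<gamma>)"
      using \<open>\<gamma> > 0\<close> by (intro add_pos_nonneg) auto
    then have "Gamma_nb \<gamma> (q \<theta>) = \<gamma> * real k / (1 + real k * (1 + \<gamma>))"
      unfolding Gamma_nb_def q using \<open>\<gamma> > 0\<close> by (simp add: divide_simps) (simp add: algebra_simps)
    then show ?thesis
      unfolding \<open>\<Psi>b = _\<close> using assms f \<open>1 < real nF\<close>
      by (intro equilibrium_wage_limit) (simp_all add: k)
  qed
  have "average_wage M TF TW (b + \<Psi>b * (y - b)) (b + \<Psi>a * (y - b)) =
      (q \<theta> * (b + \<Psi>b * (y - b)) + f / Tw * (b + \<Psi>a * (y - b))) / (q \<theta> + f / Tw)"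
    using assms f by (intro average_wage_exponential) simp_all
  also have "\<dots> = (Tw * (b + \<Psi>b * (y - b)) + \<theta> * (b + \<Psi>a * (y - b))) / (Tw + \<theta>)"
  proof -
    \<comment> \<open>Because \<open>f = \<theta> * q \<theta>\<close>, the rates
      \<open>q \<theta>\<close> and \<open>f / Tw\<close> are \<open>Tw\<close> and
      \<open>\<theta>\<close> times \<open>q \<theta> / Tw\<close>; the case
      \<open>v = w = 1\<close> gives the denominator.\<close>
    have "q \<theta> * v + f / Tw * w = (Tw * v + \<theta> * w) * (q \<theta> / Tw)" for v w
      using \<open>Tw > 0\<close> \<open>f = _\<close> by (simp add: field_simps)
    from this this[of 1 1] show ?thesis
      using \<open>Tw > 0\<close> \<open>0 < q \<theta>\<close> by simp
  qed
  also have "\<dots> = b + (Tw * \<Psi>b + \<theta> * \<Psi>a) / (Tw + \<theta>) * (y - b)"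
    using \<open>Tw > 0\<close> \<open>\<theta> > 0\<close> by (simp add: field_simps)
  finally show ?thesis
    using na nb by blast
qed

end
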